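(* Let $F$ be a forest with no vertex of degree $3$. Then $\chi_{\mathrm{g}}(F)<4$ if and only if there exists a vertex $a$ of $F$ such that, once $a$ becomes colored, every trunk $R'$ of the reduced graph $\mathcal{R}'(F)$ satisfies one of: (i) $R'$ has exactly one colored vertex and contains no edge of $E_{>>2}(\mathcal{R}'(F))$; or (ii) $R'$ has no colored vertices and there exists a vertex $v\in V(R')$ that covers $E_{>>2}(R')$.
   Context: $\chi_{\mathrm{g}}(G)$ is the least $t$ such that Alice has a winning strategy in the $t$-coloring game on $G$: Alice and Bob alternate turns, Alice first, coloring uncolored vertices with colors from a $t$-set so that no vertex gets a color used on a neighbor; Bob wins if some uncolored vertex has no available color, Alice wins if all vertices get colored. For a partially colored forest $F$, a trunk of $F$ is a maximal connected subgraph $R$ such that every colored vertex of $R$ is a leaf of $R$; $\mathcal{R}(F)$ is the partially colored forest formed by the disjoint union of all trunks of $F$ (a colored vertex lying in several trunks appears as a separate colored copy in each). For a graph $G$, $E_{>2}(G)$ is the set of edges $xy$ with $d_G(x)>2$ or $d_G(y)>2$, and $E_{>>2}(G)$ the set of edges $xy$ with $d_G(x)>2$ and $d_G(y)>2$. The reduced graph is $\mathcal{R}'(F)=\mathcal{R}(F)-\{xy: xy\notin E_{>2}(\mathcal{R}(F))\}$; its trunks are defined as for any partially colored forest. A vertex $v$ covers a set of edges if $v$ is an endpoint of every edge in the set. *)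

theory Defs
  imports Main
begin

section \<open>Simple graphs (vertex set V, edges as 2-element sets)\<close>

definition is_graph :: "'a set \<Rightarrow> 'a set set \<Rightarrow> bool" where
  "is_graph V E \<longleftrightarrow> finite V \<and>
     (\<forall>e\<in>E. \<exists>x y. x \<noteq> y \<and> e = {x, y} \<and> x \<in> V \<and> y \<in> V)"

text \<open>A cycle: a list of at least 3 distinct vertices, consecutive ones (cyclically) adjacent.\<close>
definition has_cycle :: "'a set \<Rightarrow> 'a set set \<Rightarrow> bool" where
  "has_cycle V E \<longleftrightarrow> (\<exists>vs. length vs \<ge> 3 \<and> distinct vs \<and> set vs \<subseteq> V \<and>
     (\<forall>i < length vs. {vs ! i, vs ! ((i + 1) mod length vs)} \<in> E))"

definition forest :: "'a set \<Rightarrow> 'a set set \<Rightarrow> bool" where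
  "forest V E \<longleftrightarrow> is_graph V E \<and> \<not> has_cycle V E"

definition deg :: "'a set set \<Rightarrow> 'a \<Rightarrow> nat" where
  "deg E x = card {e \<in> E. x \<in> e}"

text \<open>E_{>2} and E_{>>2} of a graph with edge set E (degrees taken in that graph).\<close>
definition E_gt2 :: "'a set set \<Rightarrow> 'a set set" where
  "E_gt2 E = {e \<in> E. \<exists>x\<in>e. deg E x > 2}"

definition E_ggt2 :: "'a set set \<Rightarrow> 'a set set" where
  "E_ggt2 E = {e \<in> E. \<forall>x\<in>e. deg E x > 2}"

definition covers :: "'a \<Rightarrow> 'a set set \<Rightarrow> bool" where
  "covers v S \<longleftrightarrow> (\<forall>e\<in>S. v \<in> e)"

section \<open>The t-coloring game\<close>

text \<open>Partial colourings: c v = None means uncoloured; colours are 0..<t.\<close>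

definition all_colored :: "'a set \<Rightarrow> ('a \<Rightarrow> nat option) \<Rightarrow> bool" where
  "all_colored V c \<longleftrightarrow> (\<forall>v\<in>V. c v \<noteq> None)"

definition blocked :: "'a set \<Rightarrow> 'a set set \<Rightarrow> nat \<Rightarrow> ('a \<Rightarrow> nat option) \<Rightarrow> bool" where
  "blocked V E t c \<longleftrightarrow> (\<exists>v\<in>V. c v = None \<and>
      (\<forall>k<t. \<exists>u. {u, v} \<in> E \<and> c u = Some k))"

definition legal_move :: "'a set \<Rightarrow> 'a set set \<Rightarrow> nat \<Rightarrow> ('a \<Rightarrow> nat option) \<Rightarrow> 'a \<Rightarrow> nat \<Rightarrow> bool" where
  "legal_move V E t c v k \<longleftrightarrow> v \<in> V \<and> c v = None \<and> k < t \<and>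
      (\<forall>u. {u, v} \<in> E \<longrightarrow> c u \<noteq> Some k)"

text \<open>alice_wins_A: Alice to move and she can force a win; alice_wins_B: Bob to move, Alice can force a win.\<close>
inductive alice_wins_A and alice_wins_B
  for V :: "'a set" and E :: "'a set set" and t :: nat where
  A_done: "all_colored V c \<Longrightarrow> alice_wins_A V E t c"
| A_move: "\<not> blocked V E t c \<Longrightarrow> legal_move V E t c v k \<Longrightarrow>
            alice_wins_B V E t (c(v := Some k)) \<Longrightarrow> alice_wins_A V E t c"
| B_done: "all_colored V c \<Longrightarrow> alice_wins_B V E t c"
| B_move: "\<not> all_colored V c \<Longrightarrow> \<not> blocked V E t c \<Longrightarrow>
            (\<And>v k. legal_move V E t c v k \<Longrightarrow> alice_wins_A V E t (c(v := Some k))) \<Longrightarrow>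
            alice_wins_B V E t c"

definition game_chromatic :: "'a set \<Rightarrow> 'a set set \<Rightarrow> nat" where
  "game_chromatic V E = (LEAST t. alice_wins_A V E t (\<lambda>_. None))"

section \<open>Trunks of a partially coloured graph (V, E) with coloured vertex set C\<close>

definition connected_sg :: "'a set \<Rightarrow> 'a set set \<Rightarrow> bool" where
  "connected_sg W D \<longleftrightarrow> W \<noteq> {} \<and> (\<forall>e\<in>D. e \<subseteq> W) \<and>
     (\<forall>x\<in>W. \<forall>y\<in>W. (x, y) \<in> {(u, w). {u, w} \<in> D}\<^sup>*)"

definition trunk_cond :: "'a set \<Rightarrow> 'a set set \<Rightarrow> 'a set \<Rightarrow> 'a set \<Rightarrow> 'a set set \<Rightarrow> bool" where
  "trunk_cond V E C W D \<longleftrightarrow> W \<subseteq> V \<and> D \<subseteq> E \<and> connected_sg W D \<and>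
     (\<forall>c\<in>W \<inter> C. deg D c = 1)"

definition trunk :: "'a set \<Rightarrow> 'a set set \<Rightarrow> 'a set \<Rightarrow> 'a set \<times> 'a set set \<Rightarrow> bool" where
  "trunk V E C T \<longleftrightarrow> trunk_cond V E C (fst T) (snd T) \<and>
     (\<forall>W' D'. trunk_cond V E C W' D' \<and> fst T \<subseteq> W' \<and> snd T \<subseteq> D' \<longrightarrow>
        W' = fst T \<and> D' = snd T)"

text \<open>R(F): disjoint union of all trunks; a vertex v of trunk T becomes the copy (T, v).\<close>
definition R_V :: "'a set \<Rightarrow> 'a set set \<Rightarrow> 'a set \<Rightarrow> (('a set \<times> 'a set set) \<times> 'a) set" where
  "R_V V E C = {(T, v). trunk V E C T \<and> v \<in> fst T}"

definition R_E :: "'a set \<Rightarrow> 'a set set \<Rightarrow> 'a set \<Rightarrow> (('a set \<times> 'a set set) \<times> 'a) set set" where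
  "R_E V E C = {{(T, u), (T, v)} | T u v. trunk V E C T \<and> {u, v} \<in> snd T}"

definition R_C :: "'a set \<Rightarrow> 'a set set \<Rightarrow> 'a set \<Rightarrow> (('a set \<times> 'a set set) \<times> 'a) set" where
  "R_C V E C = {(T, v). (T, v) \<in> R_V V E C \<and> v \<in> C}"

text \<open>R'(F) = R(F) minus all edges not in E_{>2}(R(F)); same vertices and coloured vertices.\<close>
definition R'_E :: "'a set \<Rightarrow> 'a set set \<Rightarrow> 'a set \<Rightarrow> (('a set \<times> 'a set set) \<times> 'a) set set" where
  "R'_E V E C = E_gt2 (R_E V E C)"

end

(* Call a vertex big if its degree exceeds 2, hence is at least 4. Only big vertices can become
   blocked with three colours.

   Alice maintains, on the components of uncoloured vertices joined by edges with a big end,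
   the two alternatives of the theorem, relaxed to allow several equally coloured neighbours of
   one big vertex. When Bob moves in a component without adjacent big vertices, she colours the
   big vertex next to the older coloured vertex; when he moves in a component whose
   big-big edges all contain v, she colours v (with Bob's colour if a common big neighbour w of v
   and Bob's vertex exists) or the big neighbour of Bob's vertex that lies towards v.

   If a component contains both a coloured vertex and a big-big edge, Bob pushes Alice along the
   path between them: colouring the small vertex after a big vertex that already sees a colour
   forces Alice to colour that big vertex. Reaching two adjacent big vertices u, v, he makes both
   see the same colour, and then Alice cannot parry the threats at u and at v simultaneously.
   Two disjoint big-big edges in an uncoloured component give him two such paths, or four big
   vertices in a row. With at most two colours Bob wins near any edge joining two big vertices. *)

theory Submission
  imports Defs
begin

section \<open>Paths and branches in a forest\<close>

text \<open>Excluding degree 3 gives every big vertex at least four neighbours. After two of them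
  are set aside, Bob still has two branches in which to carry out a threat, while one reply of Alice
  can spoil only one of two disjoint branches. Bob's arguments are counts of this kind, so the basic
  object is the branch of a forest at a vertex. The obstacle for Bob is the vertex \<open>a\<close>
  that Alice coloured: it may lie in one of his branches and carry the colour he wants to play
  there. It is carried along as a spoiler set \<open>B\<close>, and his forcing patterns ask for
  unequal freedom: one branch good for two colours, another only for a colour absent from
  \<open>B\<close>. Trunks of the reduced graph live in a disjoint union of copies, with degrees
  taken there. A coloured copy has degree 1 and is never big, and dropping edges between small
  vertices takes nothing from a big vertex, so bigness can be read off in the forest. Finally,
  \<open>game_chromatic\<close> is a least number and no monotonicity in the number of colours is
  assumed, so 0, 1 and 2 colours are refuted separately.\<close>

lemma rtrancl_simple_path:
  assumes "(x, y) \<in> r\<^sup>*"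
  shows "\<exists>xs. xs \<noteq> [] \<and> hd xs = x \<and> last xs = y \<and> distinct xs
    \<and> successively (\<lambda>u w. (u, w) \<in> r) xs"
  using assms
proof (induction rule: rtrancl_induct)
  case base
  show ?case by (rule exI[of _ "[x]"]) simp
next
  case (step y z)
  then obtain xs where xs: "xs \<noteq> []" "hd xs = x" "last xs = y" "distinct xs"
    "successively (\<lambda>u w. (u, w) \<in> r) xs" by blast
  show ?case
  proof (cases "z \<in> set xs")
    case True
    \<comment> \<open>The step returns to a vertex already on the list; cutting the list there keeps
      it free of repetitions.\<close>
    then obtain ys zs where e: "xs = ys @ z # zs" by (meson split_list)
    have "xs = (ys @ [z]) @ zs" using e by simp
    then have "successively (\<lambda>u w. (u, w) \<in> r) (ys @ [z])" "distinct (ys @ [z])"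
      using xs by (simp_all add: successively_append_iff)
    moreover have "hd (ys @ [z]) = x" using xs e by (cases ys) auto
    ultimately show ?thesis by - (rule exI[of _ "ys @ [z]"], simp)
  next
    case False
    then show ?thesis using xs step
      by - (rule exI[of _ "xs @ [z]"], auto simp: successively_append_iff)
  qed
qed

definition big :: "'a set set \<Rightarrow> 'a \<Rightarrow> bool" where
  "big E x \<longleftrightarrow> 2 < deg E x"

definition avoid :: "'a set set \<Rightarrow> 'a \<Rightarrow> ('a \<times> 'a) set" where
  "avoid E q = {(u, w). {u, w} \<in> E \<and> u \<noteq> q \<and> w \<noteq> q}"

text \<open>The component of \<open>x\<close> once \<open>q\<close> is deleted, normally used with
  \<open>x\<close> a neighbour of \<open>q\<close>. By reflexivity \<open>branch E q q\<close> is
  the singleton of \<open>q\<close>, which is why many facts below ask for \<open>x\<close> to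
  differ from \<open>q\<close>.\<close>

definition branch :: "'a set set \<Rightarrow> 'a \<Rightarrow> 'a \<Rightarrow> 'a set" where
  "branch E q x = {y. (x, y) \<in> (avoid E q)\<^sup>*}"

definition sees :: "'a set set \<Rightarrow> ('a \<Rightarrow> nat option) \<Rightarrow> 'a \<Rightarrow> nat \<Rightarrow> bool" where
  "sees E c v k \<longleftrightarrow> (\<exists>z. {z, v} \<in> E \<and> c z = Some k)"

text \<open>Lists the whole palette in the order of the roles the colours play: in
  \<open>finish\<close> the first two are seen by a vertex and the third is the one that blocks
  it.\<close>

definition tri :: "nat \<Rightarrow> nat \<Rightarrow> nat \<Rightarrow> bool" where
  "tri j k l \<longleftrightarrow> j < 3 \<and> k < 3 \<and> l < 3 \<and> j \<noteq> k \<and> j \<noteq> l \<and> k \<noteq> l"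

lemma branch_self [simp]: "x \<in> branch E q x"
  by (simp add: branch_def)

locale forest_graph =
  fixes V :: "'a set" and E :: "'a set set"
  assumes forest: "forest V E"
begin

lemma fin_V: "finite V"
  using forest by (simp add: forest_def is_graph_def)

lemma edge_D:
  assumes "{x, y} \<in> E" shows "x \<in> V" "y \<in> V" "x \<noteq> y"
proof -
  have "\<exists>u w. u \<noteq> w \<and> {x, y} = {u, w} \<and> u \<in> V \<and> w \<in> V"
    using forest assms by (auto simp: forest_def is_graph_def)
  then show "x \<in> V" "y \<in> V" "x \<noteq> y" by (auto simp: doubleton_eq_iff)
qed

lemma edge_obtain:
  assumes "e \<in> E" obtains x y where "e = {x, y}" "x \<noteq> y" "x \<in> V" "y \<in> V"
  using forest assms by (auto simp: forest_def is_graph_def)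

lemma fin_E: "finite E"
proof (rule finite_subset)
  show "E \<subseteq> Pow V" by (auto elim: edge_obtain)
qed (simp add: fin_V)

lemma deg_eq_card_nbrs: "deg E x = card {y. {x, y} \<in> E}"
proof -
  have "{e \<in> E. x \<in> e} = (\<lambda>y. {x, y}) ` {y. {x, y} \<in> E}"
  proof safe
    fix e assume "e \<in> E" "x \<in> e"
    then obtain y where "e = {x, y}" by (elim edge_obtain) auto
    then show "e \<in> (\<lambda>y. {x, y}) ` {y. {x, y} \<in> E}" using \<open>e \<in> E\<close> by auto
  qed
  moreover have "inj_on (\<lambda>y. {x, y}) {y. {x, y} \<in> E}"
    by (auto simp: inj_on_def doubleton_eq_iff)
  ultimately show ?thesis by (simp add: deg_def card_image)
qed

lemma fin_nbrs: "finite {y. {x, y} \<in> E}"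
  by (rule finite_subset[OF _ fin_V]) (auto dest: edge_D)

text \<open>A simple path that joins two neighbours of \<open>q\<close> and avoids \<open>q\<close>
  closes up through \<open>q\<close> to a cycle. Every appeal to acyclicity goes through this fact,
  mostly as \<open>branch_unique\<close>.\<close>

lemma nbrs_not_connected:
  assumes "{q, x} \<in> E" "{q, y} \<in> E" "x \<noteq> y"
  shows "(x, y) \<notin> (avoid E q)\<^sup>*"
proof
  assume "(x, y) \<in> (avoid E q)\<^sup>*"
  from rtrancl_simple_path[OF this] obtain xs where xs: "xs \<noteq> []" "hd xs = x" "last xs = y"
    "distinct xs" "successively (\<lambda>u w. (u, w) \<in> avoid E q) xs" by blast
  define vs where "vs = q # xs"
  \<comment> \<open>A one-element path would give \<open>x = y\<close>. With \<open>q\<close> put in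
    front, the list reaches the length 3 that \<open>has_cycle\<close> demands.\<close>
  have len: "length xs \<ge> 2"
  proof (rule ccontr)
    assume "\<not> length xs \<ge> 2"
    then obtain u where "xs = [u]" using xs(1) by (cases xs) (auto simp: not_less_eq_eq)
    then show False using xs assms(3) by auto
  qed
  have suc: "(xs ! i, xs ! Suc i) \<in> avoid E q" if "Suc i < length xs" for i
    using xs(5) that by (simp add: successively_conv_nth)
  have nq: "q \<notin> set xs"
  proof
    assume "q \<in> set xs"
    then obtain i where i: "i < length xs" "xs ! i = q" by (auto simp: in_set_conv_nth)
    show False
    proof (cases "Suc i < length xs")
      case True then show False using suc[of i] i by (auto simp: avoid_def)
    next
      case False
      then obtain k where "i = Suc k" using len i by (cases i) auto
      then show False using suc[of k] i by (auto simp: avoid_def)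
    qed
  qed
  have inV: "set vs \<subseteq> V"
  proof
    fix z assume "z \<in> set vs"
    then consider "z = q" | i where "i < length xs" "xs ! i = z"
      by (auto simp: vs_def in_set_conv_nth)
    then show "z \<in> V"
    proof cases
      case 1 then show ?thesis using assms edge_D by blast
    next
      case 2
      show ?thesis
      proof (cases "Suc i < length xs")
        case True then show ?thesis using suc[of i] 2 edge_D by (auto simp: avoid_def)
      next
        case False
        then obtain k where "i = Suc k" using len 2 by (cases i) auto
        then show ?thesis using suc[of k] 2 edge_D by (auto simp: avoid_def)
      qed
    qed
  qed
  have "{vs ! i, vs ! ((i + 1) mod length vs)} \<in> E" if i: "i < length vs" for i
  proof -
    consider "i = 0" | k where "i = Suc k" "Suc k < length xs" | "i = length xs" "i > 0"
      using i len by (cases i) (fastforce simp: vs_def less_Suc_eq)+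
    then show ?thesis
    proof cases
      case 1
      then show ?thesis using xs assms(1) by (simp add: vs_def hd_conv_nth)
    next
      case 2
      then show ?thesis using suc[of k] by (simp add: vs_def avoid_def)
    next
      case 3
      then have "vs ! i = y" using xs by (cases i) (auto simp: vs_def last_conv_nth)
      then show ?thesis using 3 assms(2) by (simp add: vs_def insert_commute)
    qed
  qed
  then have "has_cycle V E"
    unfolding has_cycle_def using inV nq len xs(4)
    by (intro exI[of _ vs]) (auto simp: vs_def)
  then show False using forest by (simp add: forest_def)
qed

lemma branch_sym: "y \<in> branch E q x \<Longrightarrow> x \<in> branch E q y"
proof -
  have "sym (avoid E q)" by (auto simp: sym_def avoid_def insert_commute)
  then show "y \<in> branch E q x \<Longrightarrow> x \<in> branch E q y"
    unfolding branch_def by (auto dest: sym_rtrancl symD)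
qed

lemma branch_ne: "y \<in> branch E q x \<Longrightarrow> x \<noteq> q \<Longrightarrow> y \<noteq> q"
  unfolding branch_def by (auto elim!: rtranclE simp: avoid_def)

lemma branch_step:
  "y \<in> branch E q x \<Longrightarrow> x \<noteq> q \<Longrightarrow> {y, z} \<in> E \<Longrightarrow> z \<noteq> q \<Longrightarrow> z \<in> branch E q x"
  using branch_ne[of y q x] unfolding branch_def
  by (auto intro: rtrancl_into_rtrancl simp: avoid_def)

lemma branch_unique: "{q, x} \<in> E \<Longrightarrow> {q, y} \<in> E \<Longrightarrow> y \<in> branch E q x \<Longrightarrow> y = x"
  using nbrs_not_connected by (auto simp: branch_def)

lemma branch_disjoint:
  assumes "{q, x} \<in> E" "{q, y} \<in> E" "x \<noteq> y" "z \<in> branch E q x" shows "z \<notin> branch E q y"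
proof
  assume "z \<in> branch E q y"
  then have "y \<in> branch E q z" by (rule branch_sym)
  then have "y \<in> branch E q x" using assms(4) by (auto simp: branch_def)
  then show False using branch_unique assms by blast
qed

text \<open>Since \<open>q\<close> is a neighbour of \<open>x\<close> other than \<open>y\<close>,
  it lies in a different branch at \<open>x\<close>. A walk from \<open>y\<close> that avoids
  \<open>x\<close> therefore never meets \<open>q\<close>, and it can be prolonged back to
  \<open>x\<close>.\<close>

lemma branch_sub:
  assumes "{q, x} \<in> E" "{x, y} \<in> E" "y \<noteq> q" "z \<in> branch E x y"
  shows "z \<in> branch E q x"
proof -
  have qn: "q \<notin> branch E x y"
    using branch_unique[of x y q] assms by (auto simp: insert_commute)
  have "(y, z) \<in> (avoid E x)\<^sup>*" using assms by (simp add: branch_def)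
  then show ?thesis
  proof (induction rule: rtrancl_induct)
    case base
    then show ?case using assms edge_D(3)[OF assms(1)] branch_step[of x q x y] by auto
  next
    case (step z z')
    have "z' \<in> branch E x y" using step by (auto simp: branch_def intro: rtrancl_into_rtrancl)
    then have "z' \<noteq> q" using qn by auto
    then show ?case using step edge_D[OF assms(1)] branch_step[of z q x z']
      by (auto simp: avoid_def)
  qed
qed

lemma branch_nbr: "{q, x} \<in> E \<Longrightarrow> {x, y} \<in> E \<Longrightarrow> y = q \<or> y \<in> branch E q x"
  using branch_step[of x q x y] edge_D(3)[of q x] by auto

lemma branch_nbr': "{q, x} \<in> E \<Longrightarrow> {y, x} \<in> E \<Longrightarrow> y = q \<or> y \<in> branch E q x"
  using branch_nbr[of q x y] by (simp add: insert_commute)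

text \<open>By \<open>branch_sub\<close> the branch at \<open>v\<close> lies inside the branch of
  \<open>u\<close> towards \<open>v\<close>, which is disjoint from all others at \<open>u\<close>.
  One move therefore cannot disturb side branches at both ends of an edge.\<close>

lemma branch_opposite:
  "{u, v} \<in> E \<Longrightarrow> {u, w} \<in> E \<Longrightarrow> w \<noteq> v \<Longrightarrow> {v, y} \<in> E \<Longrightarrow> y \<noteq> u \<Longrightarrow>
    z \<in> branch E v y \<Longrightarrow> z \<notin> branch E u w"
  using branch_sub[of u v y z] branch_disjoint[of u v w z] by (auto simp: insert_commute)

lemma branch_root: "{q, x} \<in> E \<Longrightarrow> q \<notin> branch E q x"
  using branch_ne[of q q x] edge_D[of q x] by auto

section \<open>Winning positions for Bob\<close>

abbreviation winsA where "winsA c \<equiv> alice_wins_A V E 3 c"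
abbreviation winsB where "winsB c \<equiv> alice_wins_B V E 3 c"

lemma blocked_loses:
  assumes "blocked V E t c"
  shows "\<not> alice_wins_A V E t c" "\<not> alice_wins_B V E t c"
proof -
  have "\<not> all_colored V c" using assms by (auto simp: blocked_def all_colored_def)
  then show "\<not> alice_wins_A V E t c" "\<not> alice_wins_B V E t c"
    using assms by (auto elim: alice_wins_A.cases alice_wins_B.cases)
qed

lemma bob_moves:
  assumes "legal_move V E t c v k" "\<not> alice_wins_A V E t (c(v := Some k))"
  shows "\<not> alice_wins_B V E t c"
proof
  assume "alice_wins_B V E t c"
  then show False
  proof cases
    case B_done
    then show ?thesis using assms by (auto simp: all_colored_def legal_move_def)
  qed (use assms in auto)
qed

lemma alice_moves:
  assumes "v \<in> V" "c v = None"
    and "\<And>m i. legal_move V E t c m i \<Longrightarrow> \<not> alice_wins_B V E t (c(m := Some i))"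
  shows "\<not> alice_wins_A V E t c"
proof
  assume "alice_wins_A V E t c"
  then show False
  proof cases
    case A_done
    then show ?thesis using assms by (auto simp: all_colored_def)
  qed (use assms in auto)
qed

lemma sees_upd: "sees E c v k \<Longrightarrow> c m = None \<Longrightarrow> sees E (c(m := Some i)) v k"
  by (auto simp: sees_def)

lemma sees_new: "{m, v} \<in> E \<Longrightarrow> sees E (c(m := Some i)) v i"
  by (auto simp: sees_def)

lemma sees_upd_iff:
  assumes "c m = None"
  shows "sees E (c(m := Some i)) v k \<longleftrightarrow> sees E c v k \<or> ({m, v} \<in> E \<and> i = k)"
  using assms by (auto simp: sees_def)

section \<open>Forcing patterns with three colours\<close>

lemma tri_cases: "tri j k l \<Longrightarrow> i < 3 \<Longrightarrow> i = j \<or> i = k \<or> i = l"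
  by (auto simp: tri_def)

lemma tri_blocked:
  assumes "v \<in> V" "c v = None" "tri j k l" "sees E c v j" "sees E c v k" "sees E c v l"
  shows "blocked V E 3 c"
proof -
  have "\<exists>u. {u, v} \<in> E \<and> c u = Some i" if "i < 3" for i
    using tri_cases[OF assms(3) that] assms by (auto simp: sees_def)
  then show ?thesis using assms(1,2) by (auto simp: blocked_def)
qed

text \<open>Bob's immediate threat: \<open>v\<close> already sees two colours, and its neighbour
  \<open>w\<close> can still receive the third, which blocks \<open>v\<close>.\<close>

lemma finish:
  assumes "{v, w} \<in> E" "c v = None" "c w = None" "\<not> sees E c w l"
    and "sees E c v j" "sees E c v k" "tri j k l"
  shows "\<not> winsB c"
proof (rule bob_moves)
  show "legal_move V E 3 c w l"
    using assms edge_D[OF assms(1)] by (auto simp: legal_move_def tri_def sees_def)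
  have "blocked V E 3 (c(w := Some l))"
    using assms edge_D[OF assms(1)]
    by (intro tri_blocked[of v _ j k l]) (auto intro: sees_upd sees_new simp: insert_commute)
  then show "\<not> winsA (c(w := Some l))" by (rule blocked_loses)
qed

text \<open>The colour test ranges over the whole branch, so only moves inside the branch
  can invalidate it.\<close>

definition ok :: "('a \<Rightarrow> nat option) \<Rightarrow> 'a \<Rightarrow> 'a \<Rightarrow> nat \<Rightarrow> bool" where
  "ok c u w k \<longleftrightarrow> {u, w} \<in> E \<and> c w = None \<and> (\<forall>z\<in>branch E u w. c z \<noteq> Some k)"

lemma ok_upd: "ok c u w k \<Longrightarrow> m \<notin> branch E u w \<Longrightarrow> ok (c(m := Some i)) u w k"
  by (auto simp: ok_def)

lemma ok_not_sees: "ok c u w k \<Longrightarrow> c u = None \<Longrightarrow> \<not> sees E c w k"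
  using branch_nbr'[of u w] by (fastforce simp: ok_def sees_def)

lemma ok_legal: "ok c u w k \<Longrightarrow> c u = None \<Longrightarrow> k < 3 \<Longrightarrow> legal_move V E 3 c w k"
  using ok_not_sees[of c u w k] edge_D[of u w]
  by (auto simp: legal_move_def ok_def sees_def)

lemma finish_ok:
  "ok c v w l \<Longrightarrow> c v = None \<Longrightarrow> sees E c v j \<Longrightarrow> sees E c v k \<Longrightarrow> tri j k l \<Longrightarrow> \<not> winsB c"
  using finish[of v w c l j k] ok_not_sees[of c v w l] by (auto simp: ok_def)

text \<open>Alice must answer at \<open>u\<close>, which sees \<open>j\<close> and \<open>k\<close>.
  Colouring \<open>u\<close> forces \<open>l\<close>, and then \<open>f\<close> takes
  \<open>k\<close> and blocks \<open>x\<close>. A move inside the branch of \<open>g\<close> leaves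
  \<open>x\<close> itself free to take \<open>l\<close> and block \<open>u\<close>. After any other
  move \<open>g\<close> takes \<open>l\<close>.\<close>

lemma double_threat:
  assumes "{u, x} \<in> E" "c u = None" "c x = None" "tri j k l"
    and "sees E c u j" "sees E c u k" "sees E c x j" "\<not> sees E c x l"
    and "ok c u g l" "g \<noteq> x" "ok c x f k" "f \<noteq> u"
  shows "\<not> winsA c"
proof (rule alice_moves)
  show "u \<in> V" "c u = None" using assms edge_D by auto
  fix m i assume lm: "legal_move V E 3 c m i"
  let ?c = "c(m := Some i)"
  have mN: "c m = None" using lm by (simp add: legal_move_def)
  have gu: "{u, g} \<in> E" and fx: "{x, f} \<in> E" using assms by (auto simp: ok_def)
  show "\<not> winsB ?c"
  proof (cases "m = u")
    case True
    have "i = l" using lm assms True tri_cases[OF assms(4), of i]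
      by (auto simp: legal_move_def sees_def)
    have "u \<notin> branch E x f" using branch_unique[of x f u] fx assms by (auto simp: insert_commute)
    then show ?thesis
      using True assms \<open>i = l\<close> edge_D[OF assms(1)]
      by (intro finish_ok[of ?c x f k j l])
        (auto intro: ok_upd sees_upd sees_new simp: tri_def)
  next
    case False
    show ?thesis
    proof (cases "m \<in> branch E u g")
      case True
      then have nb: "m \<notin> branch E u x" using branch_disjoint[of u g x m] gu assms by auto
      then have "m \<noteq> x" by auto
      have "{m, x} \<notin> E" using nb branch_nbr[of u x m] assms False by (auto simp: insert_commute)
      then show ?thesis using assms \<open>m \<noteq> x\<close> mN False
        by (intro finish[of u x ?c l j k]) (auto intro: sees_upd simp: sees_upd_iff)
    next
      case nb: False
      then show ?thesis using assms mN False
        by (intro finish_ok[of ?c u g l j k]) (auto intro: sees_upd ok_upd)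
    qed
  qed
qed

text \<open>Bob colours \<open>y\<close> with \<open>k\<close>, so that \<open>v\<close> sees
  \<open>j\<close> and \<open>k\<close>. Now \<open>y'\<close> holds the threat \<open>l\<close> at
  \<open>v\<close> and \<open>w\<close> the follow-up \<open>k\<close> at \<open>u\<close>: this is
  \<open>double_threat\<close> with \<open>v\<close> in the place of \<open>u\<close> and
  \<open>u\<close> in the place of \<open>x\<close>.\<close>

lemma adjacent_pair_aux:
  assumes uv: "{u, v} \<in> E" "c u = None" "c v = None" "tri j k l"
    and s: "sees E c u j" "sees E c v j" "\<not> sees E c u l"
    and ok: "ok c u w k" "w \<noteq> v" "ok c v y k" "ok c v y' l" "y \<noteq> y'" "y \<noteq> u" "y' \<noteq> u"
  shows "\<not> winsB c"
proof (rule bob_moves[of _ _ y k])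
  show "legal_move V E 3 c y k" using ok_legal[of c v y k] uv ok by (auto simp: tri_def)
  let ?c = "c(y := Some k)"
  have e: "{v, y} \<in> E" "{v, y'} \<in> E" "{u, w} \<in> E" using ok by (auto simp: ok_def)
  have yN: "c y = None" using ok by (simp add: ok_def)
  have "y \<notin> branch E v y'" using branch_unique[of v y' y] e ok by auto
  moreover have "y \<notin> branch E u w" using branch_opposite[of u v w y y] uv e ok by auto
  moreover have "y \<noteq> v" using e edge_D by blast
  ultimately show "\<not> winsA ?c"
    using uv ok s yN e
    by (intro double_threat[of v u ?c j k l y' w])
      (auto intro: ok_upd sees_upd sees_new simp: insert_commute sees_upd_iff tri_def)
qed

text \<open>Whatever Alice does, one end of the edge keeps two usable branches and the other keeps
  one. The demands on \<open>w2\<close> and \<open>y2\<close> concern \<open>k\<close> only, which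
  leaves room there for a vertex coloured earlier with another colour.\<close>

lemma adjacent_pair:
  assumes uv: "{u, v} \<in> E" "c u = None" "c v = None" "tri j k l"
    and s: "sees E c u j" "sees E c v j"
      "\<not> sees E c u l" "\<not> sees E c u k" "\<not> sees E c v l" "\<not> sees E c v k"
    and oku: "ok c u w1 k" "ok c u w1 l" "ok c u w2 k" "w1 \<noteq> w2" "w1 \<noteq> v" "w2 \<noteq> v"
    and okv: "ok c v y1 k" "ok c v y1 l" "ok c v y2 k" "y1 \<noteq> y2" "y1 \<noteq> u" "y2 \<noteq> u"
  shows "\<not> winsA c"
proof (rule alice_moves)
  show "u \<in> V" "c u = None" using uv edge_D by auto
  fix m i assume lm: "legal_move V E 3 c m i"
  let ?c = "c(m := Some i)"
  have mN: "c m = None" and i3: "i < 3" using lm by (auto simp: legal_move_def)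
  have vu: "{v, u} \<in> E" using uv by (simp add: insert_commute)
  have tri': "tri j l k" using uv by (auto simp: tri_def)
  have e: "{u, w1} \<in> E" "{u, w2} \<in> E" "{v, y1} \<in> E" "{v, y2} \<in> E"
    using oku okv by (auto simp: ok_def)
  \<comment> \<open>Alice colours an end \<open>p\<close>. The other end \<open>q\<close> then sees
    \<open>j\<close> and \<open>i\<close>, and the branch of \<open>y\<close> at \<open>q\<close>,
    untouched by her move, takes the third colour.\<close>
  have one: "\<not> winsB (c(p := Some i))"
    if "{p, q} \<in> E" "p = m" "c q = None" "sees E c q j" "sees E c p j"
      "ok c q y k" "ok c q y l" "y \<noteq> p" for p q y
  proof -
    have "i \<noteq> j" using lm that by (auto simp: legal_move_def sees_def)
    have "{q, y} \<in> E" using that by (simp add: ok_def)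
    then have "p \<notin> branch E q y" using branch_unique[of q y p] that by (auto simp: insert_commute)
    moreover have "p \<noteq> q" using that edge_D by blast
    moreover have "i = k \<or> i = l" using tri_cases[OF uv(4) i3] \<open>i \<noteq> j\<close> by auto
    ultimately show ?thesis
      using that mN uv tri'
        finish_ok[of "c(p := Some i)" q y l j k] finish_ok[of "c(p := Some i)" q y k j l]
      by (auto intro: ok_upd sees_upd sees_new)
  qed
  \<comment> \<open>Alice gives a neighbour of \<open>p\<close> a new colour. Then \<open>p\<close>
    sees two colours, and Bob blocks it by colouring the other end \<open>q\<close> with the third,
    which no neighbour of \<open>q\<close> carries.\<close>
  have two: "\<not> winsB ?c"
    if "{p, q} \<in> E" "m \<noteq> p" "m \<noteq> q" "c p = None" "c q = None" "sees E c p j" "{m, p} \<in> E" "i \<noteq> j"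
      "\<not> sees E c q l" "\<not> sees E c q k" for p q
  proof -
    have "m \<in> branch E p m" by simp
    then have "m \<notin> branch E p q" using branch_disjoint[of p m q m] that by (auto simp: insert_commute)
    then have "{m, q} \<notin> E" using branch_nbr[of p q m] that by (auto simp: insert_commute)
    moreover have "i = k \<or> i = l" using tri_cases[OF uv(4) i3] that by auto
    ultimately show ?thesis
      using that mN uv(4) tri' finish[of p q ?c l j k] finish[of p q ?c k j l]
      by (auto intro: sees_upd sees_new simp: sees_upd_iff)
  qed
  show "\<not> winsB ?c"
  proof (cases "m = u \<or> m = v")
    case True
    then show ?thesis using one[of u v y1] one[of v u w1] uv vu s oku okv by blast
  next
    case False
    show ?thesis
    proof (cases "({m, u} \<in> E \<or> {m, v} \<in> E) \<and> i \<noteq> j")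
      case True
      then consider "{m, u} \<in> E" | "{m, v} \<in> E" by blast
      then show ?thesis
      proof cases
        case 1
        then show ?thesis using two[of u v] False True uv s by blast
      next
        case 2
        then show ?thesis using two[of v u] False True uv vu s by blast
      qed
    next
      case nb: False
      have ns: "\<not> sees E ?c u l" "\<not> sees E ?c v l"
        using nb s mN uv(4) by (auto simp: sees_upd_iff tri_def)
      have com: "?c u = None" "?c v = None" "sees E ?c u j" "sees E ?c v j"
        using False uv s mN by (auto intro: sees_upd)
      \<comment> \<open>What remains are moves that spoil at most one of the four side branches. Bob
        attacks at the end where both branches are intact and uses an intact one at the other end;
        \<open>R\<close> and \<open>L\<close> are the two orientations.\<close>
      have R: "\<not> winsB ?c"
        if "m \<notin> branch E v y1" "m \<notin> branch E v y2" "m \<notin> branch E u w" "ok c u w k" "w \<noteq> v" for w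
        using that uv com ns okv
        by (intro adjacent_pair_aux[of u v ?c j k l w y2 y1]) (auto intro: ok_upd)
      have L: "\<not> winsB ?c"
        if "m \<notin> branch E u w1" "m \<notin> branch E u w2" "m \<notin> branch E v y" "ok c v y k" "y \<noteq> u" for y
        using that vu uv(4) com ns oku
        by (intro adjacent_pair_aux[of v u ?c j k l y w2 w1]) (auto intro: ok_upd)
      have d1: "m \<notin> branch E u w1 \<or> m \<notin> branch E u w2"
        using branch_disjoint[of u w1 w2 m] e oku by blast
      have d2: "m \<notin> branch E v y1 \<or> m \<notin> branch E v y2"
        using branch_disjoint[of v y1 y2 m] e okv by blast
      have d3: "m \<notin> branch E u w \<or> m \<notin> branch E v y" if "{u, w} \<in> E" "w \<noteq> v" "{v, y} \<in> E" "y \<noteq> u" for w y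
        using branch_opposite[of u v w y m] that uv by blast
      show ?thesis
        using R[of w1] R[of w2] L[of y1] L[of y2] d1 d2 d3[of w1 y1] d3[of w1 y2] d3[of w2 y1]
          d3[of w2 y2] e oku okv by blast
    qed
  qed
qed

section \<open>Alice's strategy\<close>

text \<open>Edges between two small vertices are dropped: a vertex of degree at most 2 can always be
  coloured, so it transmits no danger to another such vertex.\<close>

definition link :: "'a set \<Rightarrow> ('a \<times> 'a) set" where
  "link Y = {(x, y). {x, y} \<in> E \<and> x \<in> Y \<and> y \<in> Y \<and> (big E x \<or> big E y)}"

lemma big_in_V:
  assumes "big E w" shows "w \<in> V"
proof -
  have "{y. {w, y} \<in> E} \<noteq> {}"
    using assms unfolding big_def deg_eq_card_nbrs by (metis card.empty not_less_zero)
  then show ?thesis using edge_D by blast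
qed

lemma link_sym: "(x, y) \<in> link Y \<Longrightarrow> (y, x) \<in> link Y"
  by (auto simp: link_def insert_commute)

definition comp :: "('a \<Rightarrow> nat option) \<Rightarrow> 'a \<Rightarrow> 'a set" where
  "comp c x = {y. (x, y) \<in> (link {z. c z = None})\<^sup>*}"

definition no_bb :: "'a set \<Rightarrow> bool" where
  "no_bb K \<longleftrightarrow> (\<forall>y\<in>K. \<forall>y'\<in>K. {y, y'} \<in> E \<longrightarrow> \<not> (big E y \<and> big E y'))"

text \<open>Vacuously true for every \<open>u\<close> and \<open>k\<close> if no big vertex of
  \<open>K\<close> has a coloured neighbour; so an untouched component without big-big edges also
  falls under the first alternative of \<open>good\<close>.\<close>

definition one_touched :: "('a \<Rightarrow> nat option) \<Rightarrow> 'a set \<Rightarrow> 'a \<Rightarrow> nat \<Rightarrow> bool" where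
  "one_touched c K u k \<longleftrightarrow>
    (\<forall>y\<in>K. \<forall>z. big E y \<longrightarrow> {y, z} \<in> E \<longrightarrow> c z \<noteq> None \<longrightarrow> y = u \<and> c z = Some k)"

definition untouched :: "('a \<Rightarrow> nat option) \<Rightarrow> 'a set \<Rightarrow> bool" where
  "untouched c K \<longleftrightarrow> (\<forall>y\<in>K. \<forall>z. big E y \<longrightarrow> {y, z} \<in> E \<longrightarrow> c z = None)"

text \<open>Membership of \<open>v\<close> in \<open>K\<close> is left out so that the property
  passes to subsets; \<open>not_no_bbD\<close> recovers it as soon as \<open>K\<close> contains a
  big-big edge.\<close>

definition bb_cover :: "'a \<Rightarrow> 'a set \<Rightarrow> bool" where
  "bb_cover v K \<longleftrightarrow>
    (\<forall>y\<in>K. \<forall>y'\<in>K. {y, y'} \<in> E \<longrightarrow> big E y \<longrightarrow> big E y' \<longrightarrow> v = y \<or> v = y')"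

definition good :: "('a \<Rightarrow> nat option) \<Rightarrow> 'a set \<Rightarrow> bool" where
  "good c K \<longleftrightarrow> (no_bb K \<and> (\<exists>u k. one_touched c K u k)) \<or> (untouched c K \<and> (\<exists>v. bb_cover v K))"

text \<open>Alice restores this after each of her moves. A component in which all coloured neighbours
  attach to one big vertex and carry one colour behaves like a trunk with a single coloured
  vertex.\<close>

definition inv :: "('a \<Rightarrow> nat option) \<Rightarrow> bool" where
  "inv c \<longleftrightarrow> (\<forall>v k. c v = Some k \<longrightarrow> k < 3) \<and> (\<forall>x. c x = None \<longrightarrow> good c (comp c x))"

lemma comp_self [simp]: "x \<in> comp c x"
  by (simp add: comp_def)

lemma comp_uncoloured: "y \<in> comp c x \<Longrightarrow> c x = None \<Longrightarrow> c y = None"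
  unfolding comp_def by (auto elim!: rtranclE simp: link_def)

lemma comp_step:
  "y \<in> comp c x \<Longrightarrow> c x = None \<Longrightarrow> {y, z} \<in> E \<Longrightarrow> c z = None \<Longrightarrow> big E y \<or> big E z \<Longrightarrow> z \<in> comp c x"
  using comp_uncoloured[of y c x] unfolding comp_def
  by (auto intro: rtrancl_into_rtrancl simp: link_def)

lemma comp_sym: "y \<in> comp c x \<Longrightarrow> x \<in> comp c y"
proof -
  have "sym (link {z. c z = None})" by (auto simp: sym_def intro: link_sym)
  then show "y \<in> comp c x \<Longrightarrow> x \<in> comp c y"
    unfolding comp_def by (auto dest: sym_rtrancl symD)
qed

lemma comp_trans: "y \<in> comp c x \<Longrightarrow> z \<in> comp c y \<Longrightarrow> z \<in> comp c x"
  by (auto simp: comp_def)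

lemma comp_mono: "comp (c(m := Some i)) x \<subseteq> comp c x"
proof -
  have "link {z. (c(m := Some i)) z = None} \<subseteq> link {z. c z = None}"
    by (auto simp: link_def split: if_splits)
  from rtrancl_mono[OF this] show ?thesis unfolding comp_def by blast
qed

lemma comp_branch:
  assumes "y \<in> comp c x" "c b \<noteq> None"
  shows "y \<in> branch E b x"
proof -
  have "link {z. c z = None} \<subseteq> avoid E b" using assms by (auto simp: link_def avoid_def)
  then show ?thesis using assms unfolding comp_def branch_def by (auto dest: rtrancl_mono)
qed

text \<open>Two such neighbours would lie in one branch at the coloured vertex \<open>b\<close>. So
  a newly coloured vertex touches each remaining component in at most one vertex, which is what
  makes \<open>one_touched\<close> attainable for Alice.\<close>

lemma comp_unique:
  assumes "y \<in> comp c x" "y' \<in> comp c x" "c b \<noteq> None" "{b, y} \<in> E" "{b, y'} \<in> E"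
  shows "y = y'"
  using comp_branch[of y' c y b] comp_trans[OF comp_sym] assms branch_unique by blast

lemma good_mono:
  assumes "good c K" "K' \<subseteq> K" "\<And>y. y \<in> K' \<Longrightarrow> big E y \<Longrightarrow> {y, m} \<notin> E"
  shows "good (c(m := Some i)) K'"
proof -
  have "z \<noteq> m" if "y \<in> K'" "big E y" "{y, z} \<in> E" for y z using that assms(3) by blast
  then have t: "one_touched c K u k \<Longrightarrow> one_touched (c(m := Some i)) K' u k"
    and "untouched c K \<Longrightarrow> untouched (c(m := Some i)) K'" for u k
    using assms(2) by (auto simp: one_touched_def untouched_def)
  moreover have "no_bb K \<Longrightarrow> no_bb K'" "bb_cover v K \<Longrightarrow> bb_cover v K'" for v
    using assms(2) by (auto simp: no_bb_def bb_cover_def)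
  ultimately show ?thesis using assms(1) unfolding good_def by blast
qed

text \<open>A big uncoloured neighbour of \<open>m\<close> is linked to \<open>m\<close>, hence lies
  in its component. All other components keep their status by \<open>good_mono\<close>, and only the
  pieces of the component of \<open>m\<close> must be checked.\<close>

lemma inv_step:
  assumes "inv c" "c m = None" "i < 3"
    and "\<And>x. x \<in> comp c m \<Longrightarrow> x \<noteq> m \<Longrightarrow> good (c(m := Some i)) (comp (c(m := Some i)) x)"
  shows "inv (c(m := Some i))"
proof -
  have "good (c(m := Some i)) (comp (c(m := Some i)) x)" if "c x = None" "x \<noteq> m" for x
  proof (cases "x \<in> comp c m")
    case False
    show ?thesis
    proof (rule good_mono[OF _ comp_mono])
      show "good c (comp c x)" using assms that by (auto simp: inv_def)
      fix y assume y: "y \<in> comp (c(m := Some i)) x" "big E y"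
      then have "y \<in> comp c x" using comp_mono by blast
      then show "{y, m} \<notin> E"
        using comp_step[of y c x m] comp_sym[of m c x] that y assms(2) False by blast
    qed
  qed (use assms that in auto)
  then show ?thesis using assms by (auto simp: inv_def split: if_splits)
qed

text \<open>For replies inside the component that Bob has just entered: the position between the two
  moves may violate the invariant, so both moves are accounted for together.\<close>

lemma inv_two_steps:
  assumes "inv c" "c b = None" "j < 3" "m \<in> comp c b" "m \<noteq> b" "i < 3"
    and "\<And>x. x \<in> comp c b \<Longrightarrow> x \<noteq> b \<Longrightarrow> x \<noteq> m \<Longrightarrow>
      good (c(b := Some j, m := Some i)) (comp (c(b := Some j, m := Some i)) x)"
  shows "inv (c(b := Some j, m := Some i))"
proof -
  have cm: "c m = None" using comp_uncoloured assms by blast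
  have "good (c(b := Some j, m := Some i)) (comp (c(b := Some j, m := Some i)) x)"
    if "c x = None" "x \<noteq> b" "x \<noteq> m" for x
  proof (cases "x \<in> comp c b")
    case False
    let ?K = "comp (c(b := Some j, m := Some i)) x"
    have sub: "?K \<subseteq> comp c x" using comp_mono by blast
    have no: "{y, z} \<notin> E" if yz: "y \<in> ?K" "big E y" "z \<in> comp c b" for y z
    proof
      assume "{y, z} \<in> E"
      moreover have "y \<in> comp c x" using sub yz by blast
      moreover have "c z = None" using comp_uncoloured yz assms(2) by blast
      ultimately have "z \<in> comp c x" using comp_step \<open>c x = None\<close> yz(2) by blast
      then show False using comp_sym comp_trans yz(3) False by blast
    qed
    have "good (c(b := Some j)) ?K"
      using assms(1) that sub no by (intro good_mono[of c "comp c x"]) (auto simp: inv_def)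
    then show ?thesis using no assms(4)
      by (intro good_mono[where c = "c(b := Some j)" and K = ?K]) auto
  qed (use assms that in auto)
  then show ?thesis using assms by (auto simp: inv_def split: if_splits)
qed

lemma legal_exists:
  assumes "u \<in> V" "c u = None" "\<And>z k. {u, z} \<in> E \<Longrightarrow> c z = Some k \<Longrightarrow> k = p \<or> k = q"
  shows "\<exists>i. legal_move V E 3 c u i"
proof -
  have "\<exists>i::nat. i < 3 \<and> i \<noteq> p \<and> i \<noteq> q" by presburger
  then obtain i where "i < 3" "i \<noteq> p" "i \<noteq> q" by blast
  then have "legal_move V E 3 c u i" using assms
    by (auto simp: legal_move_def insert_commute)
  then show ?thesis by blast
qed

lemma small_legal_exists:
  assumes "u \<in> V" "c u = None" "\<not> big E u"
  shows "\<exists>i. legal_move V E 3 c u i"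
proof -
  let ?N = "{y. {u, y} \<in> E}"
  have "card ?N \<le> 2" using assms by (simp add: big_def deg_eq_card_nbrs)
  then have "\<exists>p q. ?N \<subseteq> {p, q}"
  proof -
    consider "card ?N = 0" | "card ?N = 1" | "card ?N = 2" using \<open>card ?N \<le> 2\<close> by linarith
    then show ?thesis
    proof cases
      case 1 then show ?thesis using fin_nbrs[of u] by auto
    next
      case 2 then show ?thesis by (metis card_1_singletonE subset_insertI)
    next
      case 3 then show ?thesis by (metis card_2_iff order_refl)
    qed
  qed
  then obtain p q where "?N \<subseteq> {p, q}" by blast
  \<comment> \<open>If \<open>p\<close> or \<open>q\<close> is uncoloured, the value of
    \<open>the\<close> is arbitrary. This is harmless, because only coloured neighbours restrict the
    choice of a colour.\<close>
  then show ?thesis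
    using assms by (intro legal_exists[where p = "the (c p)" and q = "the (c q)"]) auto
qed

lemma not_no_bbD:
  assumes "\<not> no_bb K" "bb_cover v K" shows "v \<in> K" "big E v"
  using assms by (auto simp: no_bb_def bb_cover_def)

lemma no_bb_mono: "no_bb K \<Longrightarrow> C \<subseteq> K \<Longrightarrow> no_bb C"
  by (auto simp: no_bb_def)

lemma no_bb_without_cover:
  "bb_cover v K \<Longrightarrow> C \<subseteq> K \<Longrightarrow> v \<notin> C \<Longrightarrow> no_bb C"
  by (auto simp: no_bb_def bb_cover_def)

lemma one_touchedI:
  assumes "\<And>y z y' z'. y \<in> C \<Longrightarrow> big E y \<Longrightarrow> {y, z} \<in> E \<Longrightarrow> c z \<noteq> None \<Longrightarrow>
    y' \<in> C \<Longrightarrow> big E y' \<Longrightarrow> {y', z'} \<in> E \<Longrightarrow> c z' \<noteq> None \<Longrightarrow> y' = y \<and> c z' = c z"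
  shows "\<exists>u k. one_touched c C u k"
proof (cases "\<exists>y z. y \<in> C \<and> big E y \<and> {y, z} \<in> E \<and> c z \<noteq> None")
  case True
  then obtain y z k where "y \<in> C" "big E y" "{y, z} \<in> E" "c z = Some k" by blast
  then have "one_touched c C y k" using assms unfolding one_touched_def by (metis option.discI)
  then show ?thesis by blast
next
  case False
  then show ?thesis unfolding one_touched_def by blast
qed

lemma one_touched_single:
  assumes "\<And>y z. y \<in> comp c x \<Longrightarrow> big E y \<Longrightarrow> {y, z} \<in> E \<Longrightarrow> c z \<noteq> None \<Longrightarrow> z = b"
  shows "\<exists>u k. one_touched c (comp c x) u k"
proof (rule one_touchedI)
  fix y z y' z'
  assume *: "y \<in> comp c x" "big E y" "{y, z} \<in> E" "c z \<noteq> None"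
    "y' \<in> comp c x" "big E y'" "{y', z'} \<in> E" "c z' \<noteq> None"
  then have "z = b" "z' = b" using assms by blast+
  then show "y' = y \<and> c z' = c z" using * comp_unique[of y c x y' b] by (auto simp: insert_commute)
qed

text \<open>Alice may not pass, so she needs a harmless move. A big vertex without big neighbours in
  its component touches no big vertex when coloured; colouring the cover \<open>v\<close> leaves
  pieces without big-big edges that are touched by \<open>v\<close> alone; and once no uncoloured
  vertex is big, every move is harmless.\<close>

lemma spare_move:
  assumes "inv c" "u \<in> V" "c u = None"
  shows "\<exists>m i. legal_move V E 3 c m i \<and> inv (c(m := Some i))"
proof (cases "\<exists>y. c y = None \<and> big E y")
  case True
  then obtain y where y: "c y = None" "big E y" by blast
  let ?K = "comp c y"
  have un: "c w = None" if "w \<in> ?K" for w using comp_uncoloured that y by blast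
  have "good c ?K" using assms y by (auto simp: inv_def)
  then consider (a) k w where "no_bb ?K" "one_touched c ?K w k"
    | (b) v where "untouched c ?K" "bb_cover v ?K" "v \<in> ?K" "big E v"
  proof -
    assume a: "\<And>w k. no_bb ?K \<Longrightarrow> one_touched c ?K w k \<Longrightarrow> thesis"
      and b: "\<And>v. untouched c ?K \<Longrightarrow> bb_cover v ?K \<Longrightarrow> v \<in> ?K \<Longrightarrow> big E v \<Longrightarrow> thesis"
    show thesis
    proof (cases "no_bb ?K")
      case True
      then have "\<exists>w k. one_touched c ?K w k" using \<open>good c ?K\<close>
        by (auto simp: good_def untouched_def one_touched_def)
      then show ?thesis using a True by blast
    next
      case False
      then show ?thesis using \<open>good c ?K\<close> b not_no_bbD by (auto simp: good_def)
    qed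
  qed
  then show ?thesis
  proof cases
    case a
    have "\<exists>m\<in>?K. big E m \<and> (\<forall>y\<in>?K. \<forall>z. big E y \<longrightarrow> {y, z} \<in> E \<longrightarrow> c z \<noteq> None \<longrightarrow> y = m)"
    proof (cases "\<exists>y\<in>?K. \<exists>z. big E y \<and> {y, z} \<in> E \<and> c z \<noteq> None")
      case True
      then show ?thesis using a(2) unfolding one_touched_def by metis
    next
      case False
      then show ?thesis using y by (intro bexI[of _ y]) auto
    qed
    then obtain m where m: "m \<in> ?K" "big E m" by blast
    have "l = k" if "{m, z} \<in> E" "c z = Some l" for z l
      using a(2) m that unfolding one_touched_def by (metis option.inject option.discI)
    then obtain i where i: "legal_move V E 3 c m i"
      using legal_exists[OF big_in_V[OF m(2)], where c = c and p = k and q = k] un[OF m(1)] by blast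
    have "inv (c(m := Some i))"
    proof (rule inv_step[OF assms(1) un[OF m(1)]])
      show "i < 3" using i by (simp add: legal_move_def)
      fix x assume x: "x \<in> comp c m"
      have "x \<in> ?K" using x m comp_trans by blast
      show "good (c(m := Some i)) (comp (c(m := Some i)) x)"
      proof (rule good_mono[OF \<open>good c ?K\<close>])
        show s: "comp (c(m := Some i)) x \<subseteq> ?K" using \<open>x \<in> ?K\<close> comp_mono comp_trans by blast
        show "{y', m} \<notin> E" if "y' \<in> comp (c(m := Some i)) x" "big E y'" for y'
          using that s m a(1) by (auto simp: no_bb_def)
      qed
    qed
    then show ?thesis using i by blast
  next
    case b
    obtain i where i: "legal_move V E 3 c v i"
      using legal_exists[of v c 0 0] b big_in_V un by (auto simp: untouched_def)
    have "inv (c(v := Some i))"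
    proof (rule inv_step[OF assms(1) un[OF b(3)]])
      show "i < 3" using i by (simp add: legal_move_def)
      fix x assume x: "x \<in> comp c v" "x \<noteq> v"
      let ?d = "c(v := Some i)"
      have "x \<in> ?K" using x b comp_trans by blast
      then have s: "comp ?d x \<subseteq> ?K" using comp_mono comp_trans by blast
      have "?d x = None" using un \<open>x \<in> ?K\<close> x by auto
      then have "v \<notin> comp ?d x" using comp_uncoloured[of v ?d x] by auto
      then have "no_bb (comp ?d x)" using no_bb_without_cover b s by blast
      moreover have "\<exists>u k. one_touched ?d (comp ?d x) u k"
      proof (rule one_touched_single)
        show "z = v" if "y' \<in> comp ?d x" "big E y'" "{y', z} \<in> E" "?d z \<noteq> None" for y' z
          using that b(1) s by (auto simp: untouched_def split: if_splits)
      qed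
      ultimately show "good ?d (comp ?d x)" by (auto simp: good_def)
    qed
    then show ?thesis using i by blast
  qed
next
  case False
  then have "\<not> big E u" using assms(3) by blast
  then obtain i where i: "legal_move V E 3 c u i"
    using small_legal_exists[of u c] assms(2,3) by blast
  let ?d = "c(u := Some i)"
  have "inv ?d"
  proof (rule inv_step[OF assms(1,3)])
    show "i < 3" using i by (simp add: legal_move_def)
    fix x assume x: "x \<in> comp c u" "x \<noteq> u"
    have "\<not> big E y" if y: "y \<in> comp ?d x" for y
    proof -
      have "y \<in> comp c u" using comp_trans[OF x(1)] y comp_mono by blast
      from comp_uncoloured[OF this assms(3)] show ?thesis using False by blast
    qed
    then have "no_bb (comp ?d x)" "one_touched ?d (comp ?d x) x 0"
      by (simp_all add: no_bb_def one_touched_def)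
    then show "good ?d (comp ?d x)" unfolding good_def by blast
  qed
  then show ?thesis using i by blast
qed

text \<open>Only the component that contains Bob's vertex needs attention. If Bob's move alone keeps
  the invariant, \<open>spare_move\<close> supplies the reply; otherwise the reply is made inside
  that component.\<close>

lemma Alice_reply:
  assumes "inv c" "legal_move V E 3 c b j" "\<not> all_colored V (c(b := Some j))"
  shows "\<exists>m i. legal_move V E 3 (c(b := Some j)) m i \<and> inv (c(b := Some j, m := Some i))"
proof -
  let ?c = "c(b := Some j)"
  let ?K = "comp c b"
  have cb: "c b = None" and j: "j < 3" using assms by (auto simp: legal_move_def)
  have un: "c w = None" if "w \<in> ?K" for w using comp_uncoloured that cb by blast
  have spare: ?thesis if "inv ?c"
    using spare_move[OF that] assms(3) by (auto simp: all_colored_def)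
  have "good c ?K" using assms cb by (auto simp: inv_def)
  have sub: "comp ?c x \<subseteq> ?K" if "x \<in> ?K" for x using that comp_mono comp_trans by blast
  have sub2: "comp (?c(m := Some i)) x \<subseteq> comp ?c x" for x m i by (rule comp_mono)
  have new: "z = b" if "untouched c ?K" "y \<in> ?K" "big E y" "{y, z} \<in> E" "?c z \<noteq> None" for y z
    using that by (auto simp: untouched_def split: if_splits)
  have single: "\<exists>u k. one_touched ?c (comp ?c x) u k" if "untouched c ?K" "x \<in> ?K" for x
    using new that sub by (intro one_touched_single[where b = b]) blast
  show ?thesis
  proof (cases "no_bb ?K")
    case nobb: True
    then obtain u k where t: "one_touched c ?K u k" using \<open>good c ?K\<close>
      by (auto simp: good_def untouched_def one_touched_def)
    consider "big E b" | "untouched c ?K" | "\<not> big E b" "\<not> untouched c ?K" by blast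
    then show ?thesis
    proof cases
      case 1
      \<comment> \<open>Without big-big edges, a big \<open>b\<close> touches no big vertex of its
        component, so the pieces inherit everything.\<close>
      have "inv ?c"
      proof (rule inv_step[OF assms(1) cb j])
        show "good ?c (comp ?c x)" if "x \<in> ?K" for x
          using sub[OF that] nobb 1 by (intro good_mono[OF \<open>good c ?K\<close>]) (auto simp: no_bb_def)
      qed
      then show ?thesis by (rule spare)
    next
      case 2
      have "inv ?c"
      proof (rule inv_step[OF assms(1) cb j])
        show "good ?c (comp ?c x)" if "x \<in> ?K" for x
          using single[OF 2 that] no_bb_mono[OF nobb sub[OF that]] by (auto simp: good_def)
      qed
      then show ?thesis by (rule spare)
    next
      case 3
      then have u: "u \<in> ?K" "big E u" using t by (auto simp: untouched_def one_touched_def)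
      then have ub: "u \<noteq> b" using 3 by blast
      \<comment> \<open>The vertex \<open>u\<close> sees at most the older colour \<open>k\<close>
        and Bob's \<open>j\<close>, so one colour is left. All older contacts were at
        \<open>u\<close> and vanish with it, \<open>u\<close> itself has no big neighbour in the
        component, and only \<open>b\<close> can touch the pieces.\<close>
      have lk: "l = k \<or> l = j" if "{u, z} \<in> E" "?c z = Some l" for z l
        using t u that unfolding one_touched_def
        by (metis fun_upd_apply option.inject option.discI)
      obtain i where i: "legal_move V E 3 ?c u i"
        using legal_exists[of u ?c k j] u ub big_in_V un lk by auto
      let ?d = "?c(u := Some i)"
      have "inv ?d"
      proof (rule inv_two_steps[OF assms(1) cb j u(1) ub])
        show "i < 3" using i by (simp add: legal_move_def)
        fix x assume x: "x \<in> ?K" "x \<noteq> b" "x \<noteq> u"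
        have s: "comp ?d x \<subseteq> ?K" using sub sub2 x by blast
        have "?d x = None" using x un by auto
        then have nu: "u \<notin> comp ?d x" using comp_uncoloured[of u ?d x] by auto
        have "\<exists>u k. one_touched ?d (comp ?d x) u k"
        proof (rule one_touched_single)
          fix y z assume y: "y \<in> comp ?d x" "big E y" "{y, z} \<in> E" "?d z \<noteq> None"
          have "z \<noteq> u" using y s u nobb by (auto simp: no_bb_def)
          then show "z = b" using y s t nu by (auto simp: one_touched_def split: if_splits)
        qed
        then show "good ?d (comp ?d x)" using no_bb_mono[OF nobb s] by (auto simp: good_def)
      qed
      then show ?thesis using i by blast
    qed
  next
    case False
    then obtain v where v: "untouched c ?K" "bb_cover v ?K" "v \<in> ?K" "big E v"
      using \<open>good c ?K\<close> not_no_bbD by (auto simp: good_def)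
    have other: "good ?c (comp ?c x)" if "x \<in> ?K" "v \<notin> comp ?c x" for x
      using single[OF v(1) that(1)] no_bb_without_cover[OF v(2) sub[OF that(1)] that(2)]
      by (auto simp: good_def)
    show ?thesis
    proof (cases "v \<noteq> b \<and> (\<exists>w\<in>comp ?c v. big E w \<and> {b, w} \<in> E)")
      case False
      \<comment> \<open>Either Bob coloured \<open>v\<close> or he touched no big vertex in the
        component of \<open>v\<close>. That component, if still there, stays untouched with the same
        cover; every other piece has lost all big-big edges and can be touched only by
        \<open>b\<close>.\<close>
      have "inv ?c"
      proof (rule inv_step[OF assms(1) cb j])
        fix x assume x: "x \<in> ?K" "x \<noteq> b"
        show "good ?c (comp ?c x)"
        proof (cases "v \<in> comp ?c x")
          case vx: True
          have "v \<noteq> b" using comp_uncoloured[OF vx] x un by auto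
          then have "{b, y} \<notin> E" if "y \<in> comp ?c x" "big E y" for y
            using comp_trans[OF comp_sym[OF vx] that(1)] that False by blast
          then have "untouched ?c (comp ?c x)"
            using new[OF v(1)] sub[OF x(1)] unfolding untouched_def by (metis insert_commute subsetD)
          moreover have "bb_cover v (comp ?c x)"
            using v(2) sub[OF x(1)] by (auto simp: bb_cover_def)
          ultimately show ?thesis by (auto simp: good_def)
        qed (use other x in auto)
      qed
      then show ?thesis by (rule spare)
    next
      case True
      then obtain w where w: "w \<in> comp ?c v" "big E w" "{b, w} \<in> E" and vb: "v \<noteq> b" by blast
      have cv: "?c v = None" using vb un v by simp
      have cw: "?c w = None" using comp_uncoloured[OF w(1) cv] .
      then have wb: "w \<noteq> b" by auto
      have wK: "w \<in> ?K" using w sub v by blast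
      have wu: "y = w" if "y \<in> comp ?c v" "{b, y} \<in> E" for y
        using comp_unique[of y ?c v w b] that w by auto
      \<comment> \<open>Colouring \<open>v\<close> destroys all big-big edges. The only danger is a
        piece touched by both \<open>b\<close> and \<open>v\<close>; condition \<open>C\<close> says
        that then both contacts are at one vertex and in one colour.\<close>
      have V: ?thesis if i: "legal_move V E 3 ?c v i"
        and C: "\<And>x y y'. ?c x = None \<Longrightarrow> x \<noteq> v \<Longrightarrow>
          y \<in> comp (?c(v := Some i)) x \<Longrightarrow> y' \<in> comp (?c(v := Some i)) x \<Longrightarrow>
          big E y' \<Longrightarrow> {b, y} \<in> E \<Longrightarrow> {v, y'} \<in> E \<Longrightarrow> y = y' \<and> i = j" for i
      proof -
        let ?d = "?c(v := Some i)"
        have "inv ?d"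
        proof (rule inv_two_steps[OF assms(1) cb j v(3) vb])
          show "i < 3" using i by (simp add: legal_move_def)
          fix x assume x: "x \<in> ?K" "x \<noteq> b" "x \<noteq> v"
          have s: "comp ?d x \<subseteq> ?K" using sub sub2 x by blast
          have cx: "?c x = None" using x un by auto
          then have "v \<notin> comp ?d x" using comp_uncoloured[of v ?d x] x by auto
          then have "no_bb (comp ?d x)" using no_bb_without_cover v s by blast
          moreover have "\<exists>u k. one_touched ?d (comp ?d x) u k"
          proof (rule one_touchedI)
            fix y z y' z'
            assume y: "y \<in> comp ?d x" "big E y" "{y, z} \<in> E" "?d z \<noteq> None"
              and y': "y' \<in> comp ?d x" "big E y'" "{y', z'} \<in> E" "?d z' \<noteq> None"
            have zz: "z = b \<or> z = v" "z' = b \<or> z' = v"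
              using y y' s new[OF v(1)] by (auto split: if_splits)
            show "y' = y \<and> ?d z' = ?d z"
            proof (cases "z = z'")
              case True
              then show ?thesis using comp_unique[of y ?d x y' z] y y' by (auto simp: insert_commute)
            next
              case False
              then consider "z = b" "z' = v" | "z = v" "z' = b" using zz by blast
              then show ?thesis
              proof cases
                case 1
                then have "y = y' \<and> i = j"
                  using C[OF cx x(3) y(1) y'(1,2)] y(3) y'(3) by (simp add: insert_commute)
                then show ?thesis using 1 vb by simp
              next
                case 2
                then have "y' = y \<and> i = j"
                  using C[OF cx x(3) y'(1) y(1,2)] y(3) y'(3) by (simp add: insert_commute)
                then show ?thesis using 2 vb by simp
              qed
            qed
          qed
          ultimately show "good ?d (comp ?d x)" by (auto simp: good_def)
        qed
        then show ?thesis using i by blast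
      qed
      consider "w = v" | "w \<noteq> v" "{v, w} \<in> E" | "w \<noteq> v" "{v, w} \<notin> E" by blast
      then show ?thesis
      proof cases
        case 1
        have "l = j" if "{v, z} \<in> E" "?c z = Some l" for z l
        proof -
          have "?c z \<noteq> None" using that(2) by simp
          from new[OF v(1) v(3) v(4) that(1) this] show ?thesis using that(2) by simp
        qed
        then obtain i where i: "legal_move V E 3 ?c v i"
          using legal_exists[OF big_in_V[OF v(4)], where c = ?c and p = j and q = j] cv by blast
        show ?thesis
        proof (rule V[OF i])
          \<comment> \<open>Here \<open>b\<close> is adjacent to \<open>v\<close>, and a piece
            touched by both would close a cycle through the edge between them. So the condition
            holds vacuously, whatever the colour \<open>i\<close>.\<close>
          fix x y y' assume *: "?c x = None" "x \<noteq> v" "y \<in> comp (?c(v := Some i)) x"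
            "y' \<in> comp (?c(v := Some i)) x" "{b, y} \<in> E" "{v, y'} \<in> E"
          have "y \<in> comp (?c(v := Some i)) y'" using * comp_trans comp_sym by blast
          then have "y \<in> branch E v y'" by (rule comp_branch) simp
          then have "b \<in> branch E v y'"
            using branch_step[of y v y' b] * vb edge_D(3)[OF *(6)] by (auto simp: insert_commute)
          then have "b = y'" using branch_unique[of v y' b] * w 1 by (auto simp: insert_commute)
          moreover have "(?c(v := Some i)) y' = None"
            using comp_uncoloured[OF *(4)] * by auto
          ultimately show "y = y' \<and> i = j" by (auto split: if_splits)
        qed
      next
        case 2
        have "{v, b} \<notin> E" using wu[of v] 2 by (auto simp: insert_commute)
        then have "?c z = None" if "{v, z} \<in> E" for z using new[OF v(1,3,4) that] that by blast
        \<comment> \<open>Any piece touched by both \<open>b\<close> and \<open>v\<close> lies in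
          the old component of \<open>v\<close> and is touched by \<open>b\<close> at
          \<open>w\<close>. The contact of \<open>v\<close> must be at \<open>w\<close> as well, so
          repeating Bob's colour makes the two agree.\<close>
        then have l: "legal_move V E 3 ?c v j"
          using cv big_in_V v j by (auto simp: legal_move_def insert_commute)
        show ?thesis
        proof (rule V[OF l])
          fix x y y' assume *: "?c x = None" "x \<noteq> v" "y \<in> comp (?c(v := Some j)) x"
            "y' \<in> comp (?c(v := Some j)) x" "big E y'" "{b, y} \<in> E" "{v, y'} \<in> E"
          have yy: "y \<in> comp (?c(v := Some j)) y'" using * comp_trans comp_sym by blast
          have "?c y' = None" using comp_uncoloured[OF *(4)] * by (auto split: if_splits)
          then have "y' \<in> comp ?c v" using comp_step[of v ?c v y'] cv * by auto
          then have "y \<in> comp ?c v" using yy sub2 comp_trans by blast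
          then have "y = w" using wu * by blast
          then show "y = y' \<and> j = j"
            using comp_unique[of y "?c(v := Some j)" x y' v] * 2 by auto
        qed
      next
        case 3
        have "l = j" if "{w, z} \<in> E" "?c z = Some l" for z l
        proof -
          have "?c z \<noteq> None" using that(2) by simp
          from new[OF v(1) wK w(2) that(1) this] show ?thesis using that(2) by simp
        qed
        then obtain i where i: "legal_move V E 3 ?c w i"
          using legal_exists[OF big_in_V[OF w(2)], where c = ?c and p = j and q = j] cw by blast
        let ?d = "?c(w := Some i)"
        \<comment> \<open>Since \<open>v\<close> covers and is not adjacent to \<open>w\<close>, no
          big-big edge ends in \<open>w\<close>, so colouring \<open>w\<close> touches no big
          vertex. As \<open>w\<close> was the only neighbour of \<open>b\<close> in the component of
          \<open>v\<close>, what remains around \<open>v\<close> is untouched.\<close>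
        have "inv ?d"
        proof (rule inv_two_steps[OF assms(1) cb j wK wb])
          show "i < 3" using i by (simp add: legal_move_def)
          fix x assume x: "x \<in> ?K" "x \<noteq> b" "x \<noteq> w"
          have s: "comp ?d x \<subseteq> ?K" using sub sub2 x by blast
          have dx: "?d x = None" using x un by auto
          have nw: "w \<notin> comp ?d x" using comp_uncoloured[of w ?d x] dx by auto
          have only_b: "z = b" if "y \<in> comp ?d x" "big E y" "{y, z} \<in> E" "?d z \<noteq> None" for y z
          proof -
            have "y \<in> ?K" using that s by blast
            have "z \<noteq> w"
            proof
              assume "z = w"
              then have "v = y \<or> v = w" using v(2) \<open>y \<in> ?K\<close> wK that w by (auto simp: bb_cover_def)
              then show False using 3 that \<open>z = w\<close> by auto
            qed
            then have "?c z \<noteq> None" using that(4) by simp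
            from new[OF v(1) \<open>y \<in> ?K\<close> that(2,3) this] show ?thesis .
          qed
          show "good ?d (comp ?d x)"
          proof (cases "v \<in> comp ?d x")
            case True
            have "{b, y} \<notin> E" if "y \<in> comp ?d x" for y
            proof
              assume "{b, y} \<in> E"
              have "y \<in> comp ?d v" using that True comp_sym comp_trans by blast
              then have "y = w" using wu \<open>{b, y} \<in> E\<close> sub2 by blast
              then show False using nw that by simp
            qed
            then have "untouched ?d (comp ?d x)"
              using only_b unfolding untouched_def by (metis insert_commute)
            moreover have "bb_cover v (comp ?d x)" using v(2) s by (auto simp: bb_cover_def)
            ultimately show ?thesis by (auto simp: good_def)
          next
            case False
            then have "no_bb (comp ?d x)" using no_bb_without_cover v s by blast
            moreover have "\<exists>u k. one_touched ?d (comp ?d x) u k"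
              using only_b by (rule one_touched_single)
            ultimately show ?thesis by (auto simp: good_def)
          qed
        qed
        then show ?thesis using i by blast
      qed
    qed
  qed
qed

section \<open>From the invariant to a winning strategy for Alice\<close>

lemma inv_big_sees_one:
  assumes "inv c" "c v = None" "big E v"
  shows "\<exists>k. \<forall>z l. {v, z} \<in> E \<longrightarrow> c z = Some l \<longrightarrow> l = k"
proof -
  have "good c (comp c v)" using assms by (auto simp: inv_def)
  then show ?thesis using assms(3) comp_self[of v c]
    unfolding good_def one_touched_def untouched_def by (metis option.discI option.inject)
qed

lemma not_blocked_if_legal:
  assumes "\<And>v. v \<in> V \<Longrightarrow> c v = None \<Longrightarrow> \<exists>i. legal_move V E t c v i"
  shows "\<not> blocked V E t c"
  using assms unfolding blocked_def legal_move_def by metis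

text \<open>Under the invariant a big vertex sees at most one colour, and one further move adds at
  most one; a small vertex has at most two neighbours. The second claim covers the moment just
  before Alice's reply.\<close>

lemma inv_not_blocked:
  assumes "inv c" shows "\<not> blocked V E 3 c" "\<not> blocked V E 3 (c(b := Some j))"
proof -
  have "\<exists>i. legal_move V E 3 c' v i" if "v \<in> V" "c' v = None" "c' = c \<or> c' = c(b := Some j)" for v c'
  proof (cases "big E v")
    case True
    have "c v = None" using that by (auto split: if_splits)
    then obtain k where "\<forall>z l. {v, z} \<in> E \<longrightarrow> c z = Some l \<longrightarrow> l = k"
      using inv_big_sees_one assms True by blast
    then show ?thesis using that
      by (intro legal_exists[of v c' k j]) (auto split: if_splits)
  qed (use small_legal_exists that in auto)
  then show "\<not> blocked V E 3 c" "\<not> blocked V E 3 (c(b := Some j))"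
    by - (rule not_blocked_if_legal, blast)+
qed

lemma inv_wins: "inv c \<Longrightarrow> winsB c"
proof (induction "card {v \<in> V. c v = None}" arbitrary: c rule: less_induct)
  case less
  show ?case
  proof (cases "all_colored V c")
    case True then show ?thesis by (rule B_done)
  next
    case False
    show ?thesis
    proof (rule B_move[OF False])
      show "\<not> blocked V E 3 c" using inv_not_blocked less by blast
      fix b j assume b: "legal_move V E 3 c b j"
      let ?c = "c(b := Some j)"
      show "winsA ?c"
      proof (cases "all_colored V ?c")
        case True then show ?thesis by (rule A_done)
      next
        case False
        then obtain m i where m: "legal_move V E 3 ?c m i" "inv (?c(m := Some i))"
          using Alice_reply less.prems b by blast
        have "card {v \<in> V. (?c(m := Some i)) v = None} < card {v \<in> V. c v = None}"
          using b fin_V by (intro psubset_card_mono) (auto simp: legal_move_def split: if_splits)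
        then have "winsB (?c(m := Some i))" using less.hyps m by blast
        then show ?thesis using m inv_not_blocked less.prems by (intro A_move) auto
      qed
    qed
  qed
qed

end

section \<open>Bob's strategy\<close>

locale forest_no3 = forest_graph +
  assumes no3: "\<forall>v\<in>V. deg E v \<noteq> 3"
begin

text \<open>The place where the absence of degree 3 enters: a big vertex has at least four
  neighbours, so two survive the removal of \<open>p\<close> and \<open>q\<close>. Two are what Bob
  needs, since one reply can spoil only one branch.\<close>

lemma big_avoid_two:
  assumes "big E u"
  obtains w1 w2 where "{u, w1} \<in> E" "{u, w2} \<in> E" "w1 \<noteq> w2" "w1 \<notin> {p, q}" "w2 \<notin> {p, q}"
proof -
  let ?N = "{y. {u, y} \<in> E}"
  have "card ?N > 2" using assms by (simp add: big_def deg_eq_card_nbrs)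
  then have "?N \<noteq> {}" by (metis card.empty not_less_zero)
  then have "u \<in> V" using edge_D by blast
  then have "card ?N \<ge> 4" using no3 \<open>card ?N > 2\<close>
    by (metis deg_eq_card_nbrs Suc_leI le_neq_implies_less eval_nat_numeral(2,3) semiring_norm(26,27) numeral_3_eq_3 numeral_2_eq_2)
  then have "card (?N - {p, q}) \<ge> 2"
    using diff_card_le_card_Diff[of "{p, q}" ?N] card_insert_le_m1[of 2 "{q}" p] by simp
  then obtain S where "S \<subseteq> ?N - {p, q}" "card S = 2" by (meson obtain_subset_with_card_n)
  then show ?thesis using that by (auto simp: card_2_iff)
qed

lemma big_avoid_three:
  assumes "big E u"
  obtains w1 w2 w3 where "{u, w1} \<in> E" "{u, w2} \<in> E" "{u, w3} \<in> E" "distinct [p, w1, w2, w3]"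
proof -
  obtain w1 w2 where "{u, w1} \<in> E" "{u, w2} \<in> E" "w1 \<noteq> w2" "w1 \<noteq> p" "w2 \<noteq> p"
    using big_avoid_two[OF assms, of p p] by auto
  moreover obtain w3 w4 where "{u, w3} \<in> E" "{u, w4} \<in> E" "w3 \<noteq> w4" "w3 \<notin> {p, w1}" "w4 \<notin> {p, w1}"
    using big_avoid_two[OF assms, of p w1] by metis
  ultimately show ?thesis using that[of w1 w3 w4] by auto
qed

definition far :: "'a set \<Rightarrow> 'a \<Rightarrow> bool" where
  "far B x \<longleftrightarrow> x \<notin> B \<and> (\<forall>b\<in>B. {b, x} \<notin> E)"

text \<open>Bob's winning trails: \<open>q\<close> is coloured and \<open>u\<close> is its neighbour; big and small vertices
  alternate until two big vertices are adjacent. The vertices of \<open>B\<close> (at most one) may be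
  coloured, but are kept away from the big vertices of the trail.\<close>

inductive chain :: "'a set \<Rightarrow> 'a \<Rightarrow> 'a \<Rightarrow> bool" for B where
  base: "{u, v} \<in> E \<Longrightarrow> v \<noteq> q \<Longrightarrow> big E u \<Longrightarrow> big E v \<Longrightarrow> far B u \<Longrightarrow> far B v \<Longrightarrow> chain B q u"
| step: "big E u \<Longrightarrow> far B u \<Longrightarrow> {u, s} \<in> E \<Longrightarrow> s \<noteq> q \<Longrightarrow> \<not> big E s \<Longrightarrow> {s, u'} \<in> E \<Longrightarrow> u' \<noteq> u \<Longrightarrow>
    chain B s u' \<Longrightarrow> chain B q u"

lemma chain_far: "chain B q u \<Longrightarrow> far B u \<and> big E u"
  by (auto elim: chain.cases)

lemma small_nbrs:
  assumes "\<not> big E s" "{s, x} \<in> E" "{s, y} \<in> E" "x \<noteq> y" "{s, z} \<in> E"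
  shows "z = x \<or> z = y"
proof (rule ccontr)
  assume "\<not> ?thesis"
  then have "card {x, y, z} = 3" using assms by auto
  moreover have "card {x, y, z} \<le> card {y. {s, y} \<in> E}"
    using assms by (intro card_mono fin_nbrs) auto
  ultimately show False using assms(1) by (simp add: big_def deg_eq_card_nbrs)
qed

lemma third_colour:
  assumes "j < 3" shows "\<exists>k l. tri j k l \<and> d \<noteq> Some k"
proof -
  consider "j = 0" | "j = 1" | "j = 2" using assms by linarith
  then show ?thesis
  proof cases
    case 1
    then have "tri j 1 2" "tri j 2 1" by (auto simp: tri_def)
    then show ?thesis by (cases "d = Some 1") auto
  next
    case 2
    then have "tri j 0 2" "tri j 2 0" by (auto simp: tri_def)
    then show ?thesis by (cases "d = Some 0") auto
  next
    case 3
    then have "tri j 0 1" "tri j 1 0" by (auto simp: tri_def)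
    then show ?thesis by (cases "d = Some 0") auto
  qed
qed

text \<open>Choosing as \<open>k\<close> a colour that does not occur on \<open>B\<close> makes
  every branch that is otherwise uncoloured satisfy \<open>ok\<close> for \<open>k\<close>, even the
  one containing the spoiler.\<close>

lemma spoiler_colour:
  assumes "j < 3" "\<And>x y. x \<in> B \<Longrightarrow> y \<in> B \<Longrightarrow> x = y"
  shows "\<exists>k l. tri j k l \<and> (\<forall>b\<in>B. c b \<noteq> Some k)"
proof (cases "B = {}")
  case True then show ?thesis using third_colour[OF assms(1), of None] by auto
next
  case False
  then obtain b where "b \<in> B" by auto
  then show ?thesis using third_colour[OF assms(1), of "c b"] assms(2) by metis
qed

lemma tri_sym: "tri j k l \<Longrightarrow> tri j l k"
  by (auto simp: tri_def)

lemma okI: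
  assumes "{u, w} \<in> E" "c w = None" "\<forall>z\<in>branch E u w. z \<notin> B \<longrightarrow> c z = None"
    and "(\<forall>b\<in>B. c b \<noteq> Some k) \<or> branch E u w \<inter> B = {}"
  shows "ok c u w k"
  using assms unfolding ok_def by (metis disjoint_iff option.discI)

lemma far_nbr: "far B u \<Longrightarrow> {u, w} \<in> E \<Longrightarrow> w \<notin> B"
  by (auto simp: far_def insert_commute)

text \<open>The hypothesis on the branch is what makes the induction run: the branch at
  \<open>s\<close> towards \<open>u'\<close> lies inside the branch at \<open>q\<close> towards
  \<open>u\<close>, so a forced reply at \<open>u\<close> leaves the rest of the trail
  clear.\<close>

lemma chain_wins_Bob:
  assumes "chain B q u" "{q, u} \<in> E" "c q = Some j" "j < 3"
    and "\<And>x y. x \<in> B \<Longrightarrow> y \<in> B \<Longrightarrow> x = y"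
    and "\<forall>z\<in>branch E q u. z \<notin> B \<longrightarrow> c z = None"
  shows "\<not> winsB c"
  using assms
proof (induction arbitrary: c j rule: chain.induct)
  case (base u v q)
  have qu: "{q, u} \<in> E" "{v, u} \<in> E" using base by (auto simp: insert_commute)
  have ne: "u \<noteq> v" "q \<noteq> u" using base edge_D by blast+
  have free: "c z = None" if "z \<in> branch E q u" "z \<notin> B" for z using base that by blast
  have sub: "z \<in> branch E q u" if "{u, w} \<in> E" "w \<noteq> q" "z \<in> branch E u w" for w z
    using branch_sub[of q u w z] that qu by blast
  have subv: "z \<in> branch E q u" if "{v, w} \<in> E" "w \<noteq> u" "z \<in> branch E v w" for w z
    using branch_sub[of u v w z] that base sub[of v z] by blast
  have uB: "u \<notin> B" "v \<notin> B" using base by (auto simp: far_def)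
  have cu: "c u = None" using free[of u] uB by simp
  have cv: "c v = None" using free[of v] sub[of v v] base uB by simp
  have nu: "c w = None" if "{u, w} \<in> E" "w \<noteq> q" for w
    using free[of w] sub[of w w] that far_nbr base by simp
  have nv: "c w = None" if "{v, w} \<in> E" for w
    using free[of w] subv[of w w] that far_nbr base cu by (cases "w = u") auto
  obtain k l where kl: "tri j k l" "\<forall>b\<in>B. c b \<noteq> Some k"
    using spoiler_colour[OF base(9), of B c] base(10) by blast
  obtain w w' where w: "{u, w} \<in> E" "{u, w'} \<in> E" "w \<noteq> w'" "w \<notin> {q, v}" "w' \<notin> {q, v}"
    using big_avoid_two[OF base(3)] by metis
  have oneB: "branch E x y \<inter> B = {} \<or> branch E x y' \<inter> B = {}"
    if "{x, y} \<in> E" "{x, y'} \<in> E" "y \<noteq> y'" for x y y'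
    using branch_disjoint[of x y y'] that base(10) by blast
  obtain w1 w2 where w12: "{u, w1} \<in> E" "{u, w2} \<in> E" "w1 \<noteq> w2" "w1 \<notin> {q, v}" "w2 \<notin> {q, v}"
    "branch E u w1 \<inter> B = {}"
    using w oneB[of u w w'] by metis
  obtain t1 t2 t3 where t: "{v, t1} \<in> E" "{v, t2} \<in> E" "{v, t3} \<in> E" "distinct [u, t1, t2, t3]"
    using big_avoid_three[OF base(4)] by metis
  \<comment> \<open>At most one of the three branches at \<open>v\<close> beyond \<open>u\<close>
    meets \<open>B\<close>. It is assigned to \<open>y2\<close>, the only one for which a single
    colour suffices.\<close>
  have "\<exists>y1 y2 z. {v, y1} \<in> E \<and> {v, y2} \<in> E \<and> {v, z} \<in> E \<and> distinct [u, y1, y2, z] \<and>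
    branch E v y1 \<inter> B = {} \<and> branch E v z \<inter> B = {}"
  proof (cases "branch E v t1 \<inter> B = {}")
    case True
    then show ?thesis using oneB[of v t2 t3] t by (metis distinct_length_2_or_more)
  next
    case False
    then have "branch E v t2 \<inter> B = {}" "branch E v t3 \<inter> B = {}"
      using oneB[of v t1 t2] oneB[of v t1 t3] t by auto
    then show ?thesis using t by (intro exI[of _ t2] exI[of _ t1] exI[of _ t3]) auto
  qed
  then obtain y1 y2 z where y: "{v, y1} \<in> E" "{v, y2} \<in> E" "{v, z} \<in> E" "distinct [u, y1, y2, z]"
    "branch E v y1 \<inter> B = {}" "branch E v z \<inter> B = {}" by blast
  \<comment> \<open>Bob will give \<open>z\<close> the colour \<open>j\<close> that \<open>u\<close>
    already sees through \<open>q\<close>, so that both ends of the edge see the same single colour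
    as \<open>adjacent_pair\<close> requires.\<close>
  have okz: "ok c v z j" using y subv[of z] free nv by (intro okI[where B = B]) auto
  let ?c = "c(z := Some j)"
  have zu: "z \<notin> branch E u x" if "{u, x} \<in> E" "x \<noteq> v" for x
    using branch_opposite[of u v x z z] that base(1) y by auto
  have zv: "z \<notin> branch E v x" if "{v, x} \<in> E" "x \<noteq> z" for x
    using branch_unique[of v x z] that y by auto
  have zn: "z \<noteq> u" "z \<noteq> v" using y edge_D(3)[of v z] by auto
  have okw: "ok c u w1 k" "ok c u w1 l" "ok c u w2 k"
    using w12 kl nu sub[of w1] sub[of w2] free by (intro okI[where B = B]; simp)+
  have oky: "ok c v y1 k" "ok c v y1 l" "ok c v y2 k"
    using y kl nv subv[of y1] subv[of y2] free by (intro okI[where B = B]; auto)+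
  have su: "\<not> sees E ?c u i" if "i \<noteq> j" for i
    using that nu base(8)
    by (auto simp: sees_def insert_commute) (metis option.inject option.distinct(1))
  have sv: "\<not> sees E ?c v i" if "i \<noteq> j" for i
    using that nv by (auto simp: sees_def insert_commute)
  have kj: "k \<noteq> j" "l \<noteq> j" using kl by (auto simp: tri_def)
  show ?case
  proof (rule bob_moves)
    show "legal_move V E 3 c z j" using ok_legal okz cv base by blast
    show "\<not> winsA ?c"
    proof (rule adjacent_pair[of u v _ j k l w1 w2 y1 y2])
      show "sees E ?c u j" using qu(1) base(8) by (auto simp: sees_def intro!: exI[of _ q])
      show "sees E ?c v j" using y by (auto simp: sees_def insert_commute)
      show "ok ?c u w1 k" "ok ?c u w1 l" "ok ?c u w2 k"
        using okw zu w12 by (auto intro: ok_upd)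
      show "ok ?c v y1 k" "ok ?c v y1 l" "ok ?c v y2 k"
        using oky zv y by (auto intro: ok_upd)
    qed (use base kl cu cv zn su sv kj w12 y in auto)
  qed
next
  case (step u s q u')
  have qu: "{q, u} \<in> E" "{s, u} \<in> E" using step by (auto simp: insert_commute)
  have ne: "u \<noteq> s" "q \<noteq> u" "s \<noteq> u'" using step edge_D by blast+
  have free: "c z = None" if "z \<in> branch E q u" "z \<notin> B" for z using step that by blast
  have sub: "z \<in> branch E q u" if "{u, w} \<in> E" "w \<noteq> q" "z \<in> branch E u w" for w z
    using branch_sub[of q u w z] that qu by blast
  have subs: "z \<in> branch E q u" if "z \<in> branch E s u'" for z
    using branch_sub[of u s u' z] that step sub[of s z] by blast
  have far': "far B u'" using chain_far[OF step(8)] by simp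
  have cu: "c u = None" "c u' = None" using free[of u] free[of u'] subs[of u'] step(2) far'
    by (auto simp: far_def)
  have nu: "c w = None" if "{u, w} \<in> E" "w \<noteq> q" for w
    using free[of w] sub[of w w] that far_nbr[OF step(2)] by simp
  have ns: "z = u \<or> z = u'" if "{s, z} \<in> E" for z
    using small_nbrs[of s u u' z] that step qu by auto
  have nsN: "c z = None" if "{s, z} \<in> E" for z using ns[OF that] cu by blast
  \<comment> \<open>Here the colour absent from \<open>B\<close> is \<open>l\<close>, reserved for
    the threat at \<open>u\<close> in the branches of \<open>w\<close> and \<open>w'\<close>; Bob
    plays \<open>k\<close> at the small vertex \<open>s\<close>.\<close>
  obtain l k where kl: "tri j l k" "\<forall>b\<in>B. c b \<noteq> Some l"
    using spoiler_colour[OF step(12), of B c] step(13) by blast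
  obtain w w' where w: "{u, w} \<in> E" "{u, w'} \<in> E" "w \<noteq> w'" "w \<notin> {q, s}" "w' \<notin> {q, s}"
    using big_avoid_two[OF step(1)] by metis
  have cs: "c s = None" using nu step by blast
  let ?c = "c(s := Some k)"
  have "sees E ?c u j" using step qu(1) by (auto simp: sees_def intro!: exI[of _ q])
  moreover have "sees E ?c u k" using qu(2) by (auto simp: sees_def)
  ultimately have sju: "sees E ?c u j" "sees E ?c u k" .
  have okw: "ok ?c u w l" "ok ?c u w' l"
  proof -
    have "s \<notin> branch E u w" "s \<notin> branch E u w'"
      using branch_unique[of u w s] branch_unique[of u w' s] w step by auto
    moreover have "ok c u w l" "ok c u w' l"
      using w nu sub[of w] sub[of w'] free kl by (intro okI[where B = B]; auto)+
    ultimately show "ok ?c u w l" "ok ?c u w' l" by (auto intro: ok_upd)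
  qed
  show ?case
  proof (rule bob_moves)
    show "legal_move V E 3 c s k"
      using nsN cs kl edge_D[OF qu(2)] by (auto simp: legal_move_def tri_def insert_commute)
    show "\<not> winsA ?c"
    proof (rule alice_moves)
      show "u \<in> V" "?c u = None" using qu edge_D cu ne by auto
      fix m i assume lm: "legal_move V E 3 ?c m i"
      let ?d = "?c(m := Some i)"
      have mN: "?c m = None" using lm by (simp add: legal_move_def)
      show "\<not> winsB ?d"
      proof (cases "m = u")
        case True
        \<comment> \<open>The forced reply has been made: \<open>s\<close> with colour
          \<open>k\<close> takes over the role of \<open>q\<close> for the remaining trail.\<close>
        have "u \<notin> branch E s u'" using branch_unique[of s u' u] step qu by auto
        moreover have "s \<notin> branch E s u'" using branch_root step by blast
        ultimately have "\<forall>z\<in>branch E s u'. z \<notin> B \<longrightarrow> ?d z = None"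
          using subs free True by auto
        then show ?thesis using True ne kl step by (intro step.IH[of ?d k]) (auto simp: tri_def)
      next
        case False
        have "m \<notin> branch E u w \<or> m \<notin> branch E u w'" using branch_disjoint[of u w w' m] w by blast
        then have "ok ?d u w l \<or> ok ?d u w' l" using okw ok_upd by blast
        moreover have "sees E ?d u j" "sees E ?d u k" using sju mN by (auto intro: sees_upd)
        moreover have "?d u = None" using False cu ne by simp
        ultimately show ?thesis using finish_ok tri_sym[OF kl(1)] by blast
      qed
    qed
  qed
qed

text \<open>Once \<open>s\<close> is coloured it starts two trails in disjoint branches. Alice's
  reply lies in at most one of them, and Bob follows the other.\<close>

lemma small_between_chains:
  assumes "\<not> big E s" "{s, x} \<in> E" "{s, y} \<in> E" "x \<noteq> y" "chain B s x" "chain B s y"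
    and "\<And>x y. x \<in> B \<Longrightarrow> y \<in> B \<Longrightarrow> x = y" and "\<forall>z. z \<notin> B \<longrightarrow> c z = None"
  shows "\<not> winsB c"
proof (rule bob_moves)
  have f: "far B x" "far B y" using assms chain_far by blast+
  have sB: "s \<notin> B" using far_nbr[OF f(1), of s] assms(2) by (simp add: insert_commute)
  have "c z = None" if "{s, z} \<in> E" for z
    using small_nbrs[of s x y z] assms that f by (auto simp: far_def)
  then show "legal_move V E 3 c s 0"
    using assms edge_D[OF assms(2)] sB by (auto simp: legal_move_def insert_commute)
  let ?c = "c(s := Some 0)"
  show "\<not> winsA ?c"
  proof (rule alice_moves)
    show "x \<in> V" "?c x = None" using assms f edge_D[OF assms(2)] by (auto simp: far_def)
    fix m i assume lm: "legal_move V E 3 ?c m i"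
    let ?d = "?c(m := Some i)"
    have ms: "m \<noteq> s" using lm by (auto simp: legal_move_def)
    have w: "\<not> winsB ?d" if "{s, v} \<in> E" "chain B s v" "m \<notin> branch E s v" for v
    proof (rule chain_wins_Bob[OF that(2,1) _ _ assms(7)])
      show "?d s = Some 0" "(0::nat) < 3" using ms by auto
      show "\<forall>z\<in>branch E s v. z \<notin> B \<longrightarrow> ?d z = None"
        using that branch_root[of s v] assms by auto
    qed
    show "\<not> winsB ?d"
      using w[of x] w[of y] branch_disjoint[of s x y m] assms by blast
  qed
qed

text \<open>Bob opens with a neighbour of \<open>x\<close> outside the row. The condition on the branch, which
  holds after reversing the row if necessary, keeps the spoiler away from \<open>x\<close> and \<open>u\<close>.\<close>

lemma four_big_in_row:
  assumes e: "{x, u} \<in> E" "{u, v} \<in> E" "{v, y} \<in> E" "x \<noteq> v" "u \<noteq> y"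
    and big: "big E x" "big E u" "big E v" "big E y"
    and far: "far B x" "far B u" "far B v" "far B y"
    and B: "\<And>x y. x \<in> B \<Longrightarrow> y \<in> B \<Longrightarrow> x = y" "branch E v u \<inter> B = {}"
    and c: "\<forall>z. z \<notin> B \<longrightarrow> c z = None"
  shows "\<not> winsB c"
proof -
  have e': "{u, x} \<in> E" "{v, u} \<in> E" "{y, v} \<in> E" using e by (auto simp: insert_commute)
  have ne: "x \<noteq> u" "u \<noteq> v" "v \<noteq> y" using e edge_D by blast+
  have inB: "x \<notin> B" "u \<notin> B" "v \<notin> B" "y \<notin> B" using far by (auto simp: far_def)
  have nb: "c z = None" if "{p, z} \<in> E" "far B p" for p z using far_nbr that c by blast
  have sub_u: "z \<in> branch E v u" if "{u, p} \<in> E" "p \<noteq> v" "z \<in> branch E u p" for z p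
    using branch_sub[of v u p z] that e' by blast
  have sub_x: "z \<in> branch E u x" if "{x, p} \<in> E" "p \<noteq> u" "z \<in> branch E x p" for z p
    using branch_sub[of u x p z] that e' by blast
  obtain w f1 f2 where f: "{x, w} \<in> E" "{x, f1} \<in> E" "{x, f2} \<in> E" "distinct [u, w, f1, f2]"
    using big_avoid_three[OF big(1)] by metis
  obtain g1 g2 where g: "{u, g1} \<in> E" "{u, g2} \<in> E" "g1 \<noteq> g2" "g1 \<notin> {x, v}" "g2 \<notin> {x, v}"
    using big_avoid_two[OF big(2)] by metis
  have clear_u: "c z = None" if "{u, p} \<in> E" "p \<noteq> v" "z \<in> branch E u p" for p z
    using sub_u[OF that] B c by blast
  have clear_x: "c z = None" if "{x, p} \<in> E" "p \<noteq> u" "z \<in> branch E x p" for p z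
    using clear_u[of x z] sub_x[OF that] e' e by blast
  have wx: "w \<in> branch E u x" using sub_x[of w w] f by auto
  have wu: "w \<notin> branch E u p" if "{u, p} \<in> E" "p \<noteq> x" for p
    using branch_disjoint[of u x p w] that e' wx by blast
  have wf: "w \<notin> branch E x p" if "{x, p} \<in> E" "p \<noteq> w" for p
    using branch_unique[of x p w] that f by auto
  have wne: "w \<noteq> x" "w \<noteq> u" "w \<noteq> v"
    using edge_D(3)[of x w] f branch_unique[of u x v] e e' wx by auto
  let ?c = "c(w := Some 0)"
  have okw: "ok c x w k" for k
    using f nb[of x w] far clear_x[of w] by (auto simp: ok_def)
  have okf: "ok ?c x p k" if "{x, p} \<in> E" "p \<notin> {u, w}" for p k
    using ok_upd[of c x p k w 0] wf[of p] that nb[of x p] far clear_x[of p] by (auto simp: ok_def)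
  have okg: "ok ?c u p k" if "{u, p} \<in> E" "p \<notin> {x, v}" for p k
    using ok_upd[of c u p k w 0] wu[of p] that nb[of u p] far clear_u[of p] by (auto simp: ok_def)
  have cN: "?c x = None" "?c u = None" "?c v = None" using inB c wne by auto
  have chv: "chain B u v" using e big far by (intro chain.base[of v y]) auto
  have brv: "\<forall>z\<in>branch E u v. z \<notin> B \<longrightarrow> ?c z = None" using wu[of v] e c by auto
  have see_w: "sees E ?c x 0" using f by (auto simp: sees_def insert_commute)
  have nsee_x: "\<not> sees E ?c x k" if "k \<noteq> 0" for k
    using nb[of x] far that by (auto simp: sees_def insert_commute)
  have nsee_u: "\<not> sees E ?c u k" for k
  proof -
    have "{u, w} \<notin> E" using branch_unique[of u x w] e' wx wne by blast
    then show ?thesis using nb[of u] far by (auto simp: sees_def insert_commute)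
  qed
  show ?thesis
  proof (rule bob_moves)
    show "legal_move V E 3 c w 0" using ok_legal[of c x w 0] okw inB c by auto
    show "\<not> winsA ?c"
    proof (rule alice_moves)
      show "u \<in> V" "?c u = None" using e edge_D cN by auto
      fix m i assume lm: "legal_move V E 3 ?c m i"
      let ?d = "?c(m := Some i)"
      have mN: "?c m = None" and i3: "i < 3" using lm by (auto simp: legal_move_def)
      then have mw: "m \<noteq> w" by auto
      have su: "sees E ?d p k" if "sees E ?c p k" for p k using sees_upd[of ?c p k m i] that mN by simp
      have okd: "ok ?d p q k" if "ok ?c p q k" "m \<notin> branch E p q" for p q k
        using ok_upd[of ?c p q k m i] that by simp
      show "\<not> winsB ?d"
      proof -
        \<comment> \<open>A reply at \<open>x\<close> or at \<open>u\<close> starts a trail at once,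
          as the next two vertices of the row form a big-big edge. In the other cases Bob uses that
          \<open>x\<close> already sees 0.\<close>
        consider "m = x" | "m = u" | "m = v" | "m \<in> branch E u v" "m \<noteq> v"
          | "m \<notin> branch E u v" "m \<noteq> u" "m \<noteq> x" by blast
        then show ?thesis
        proof cases
          case 1
          have "chain B x u" using e big far by (intro chain.base[of u v]) auto
          moreover have "\<forall>z\<in>branch E x u. z \<notin> B \<longrightarrow> ?d z = None"
            using wf[of u] branch_root[of x u] e c 1 f by auto
          ultimately show ?thesis using 1 e i3 B by (intro chain_wins_Bob[of B x u ?d i]) auto
        next
          case 2
          then show ?thesis using chv e i3 B brv branch_root[of u v]
            by (intro chain_wins_Bob[of B u v ?d i]) auto
        next
          case 3
          \<comment> \<open>The colour \<open>s\<close> is chosen for \<open>g1\<close> so that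
            \<open>u\<close>, which already sees \<open>i\<close> through \<open>v\<close>, ends up
            seeing exactly 0 and one further colour \<open>k\<close>: a new colour if Alice played
            0, and 0 otherwise.\<close>
          obtain s k l where s: "tri 0 k l" "i = 0 \<longrightarrow> s = k" "i \<noteq> 0 \<longrightarrow> s = 0 \<and> i = k"
          proof (cases "i = 0")
            case True
            then show ?thesis using that[of 1 2 1] by (simp add: tri_def)
          next
            case False
            then show ?thesis using i3 that[of i "if i = 1 then 2 else 1" 0] by (auto simp: tri_def)
          qed
          have s3: "s < 3" "{i, s} = {0, k}" using s by (auto simp: tri_def)
          have vf: "v \<notin> branch E u p" if "{u, p} \<in> E" "p \<noteq> v" for p
            using branch_unique[of u p v] that e by auto
          have vx: "v \<notin> branch E x p" if "{x, p} \<in> E" "p \<noteq> u" for p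
            using sub_x[OF that, of v] vf[of x] e e' by auto
          have okg1: "ok ?d u g1 s" "ok ?d u g2 l" using okg g vf 3 okd by auto
          let ?e = "?d(g1 := Some s)"
          have g1x: "g1 \<notin> branch E x p" if "{x, p} \<in> E" "p \<noteq> u" for p
            using sub_x[OF that, of g1] branch_unique[of u x g1] g e' by auto
          have g1u: "g1 \<notin> branch E u g2" using branch_unique[of u g2 g1] g by auto
          have gne: "g1 \<noteq> u" "g1 \<noteq> x" using edge_D(3)[of u g1] g by auto
          have gx: "{x, g1} \<notin> E" using g1x[of g1] gne by auto
          have vxE: "{x, v} \<notin> E" using vx[of v] ne by auto
          have dN: "?d g1 = None" "?d u = None" "?d x = None" using okg1 3 cN ne e by (auto simp: ok_def)
          have "sees E ?d u i" "sees E ?e u s" using 3 e' g by (auto simp: sees_def insert_commute)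
          then have "sees E ?e u i" "sees E ?e u s" using dN by (auto intro: sees_upd)
          then have "sees E ?e u 0" "sees E ?e u k" using s3 by (metis insertCI insertE singletonD)+
          moreover have "\<not> sees E ?e x l"
          proof -
            have "{g1, x} \<notin> E" "{m, x} \<notin> E" using gx vxE 3 by (auto simp: insert_commute)
            then have "\<not> sees E ?d x l" using nsee_x[of l] s mN
              by (subst sees_upd_iff) (auto simp: tri_def)
            then show ?thesis using \<open>{g1, x} \<notin> E\<close> dN by (subst sees_upd_iff) auto
          qed
          moreover have "sees E ?e x 0" using su[OF see_w] dN by (auto intro: sees_upd)
          moreover have "ok ?e u g2 l" using okg1 g1u by (auto intro: ok_upd)
          moreover have "ok ?e x f1 k" using okd[OF okf[of f1 k]] vx[of f1] g1x[of f1] f 3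
            by (auto intro: ok_upd)
          ultimately have "\<not> winsA ?e"
            using s(1) e' dN gne f g
            by (intro double_threat[of u x ?e 0 k l g2 f1]) auto
          moreover have "legal_move V E 3 ?d g1 s" using ok_legal[OF okg1(1)] dN s3 by simp
          ultimately show ?thesis using bob_moves by blast
        next
          case 4
          have mp: "m \<notin> branch E u p" if "{u, p} \<in> E" "p \<noteq> v" for p
            using branch_disjoint[of u v p m] that e 4 by auto
          have mx: "m \<notin> branch E x p" if "{x, p} \<in> E" "p \<noteq> u" for p
            using sub_x[OF that, of m] mp[of x] e e' by auto
          have mne: "m \<noteq> u" "m \<noteq> x" using branch_root[of u v] 4 e e' mp[of x] by auto
          have mE: "{m, u} \<notin> E" "{m, x} \<notin> E"
            using branch_unique[of u v m] 4 e mx[of m] mne by (auto simp: insert_commute)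
          have dN: "?d u = None" "?d x = None" "?d v = None" using cN mne 4 by auto
          have seed: "sees E ?d x 0" using su[OF see_w] .
          have nseed: "\<not> sees E ?d u k" "k \<noteq> 0 \<Longrightarrow> \<not> sees E ?d x k" for k
            using nsee_u nsee_x[of k] mE mN by (auto simp: sees_upd_iff)
          have okgd: "ok ?d u p k" if "{u, p} \<in> E" "p \<notin> {x, v}" for p k
            using okd[OF okg] mp that by auto
          have okfd: "ok ?d x p k" if "{x, p} \<in> E" "p \<notin> {u, w}" for p k
            using okd[OF okf] mx that by auto
          show ?thesis
          proof (cases "sees E ?d v 0")
            case False
            \<comment> \<open>With 0 at \<open>v\<close>, the vertex \<open>u\<close> sees the same
              colour as \<open>x\<close>, and \<open>u\<close>, \<open>x\<close> become the pair of
              \<open>adjacent_pair\<close>.\<close>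
            let ?e = "?d(v := Some 0)"
            have "legal_move V E 3 ?d v 0"
              using False dN edge_D[OF e(2)] by (auto simp: legal_move_def sees_def)
            moreover have "\<not> winsA ?e"
            proof (rule adjacent_pair[of u x ?e 0 1 2 g1 g2 f1 f2])
              have vE: "{v, x} \<notin> E" using branch_unique[of u x v] branch_nbr[of u x v] e e' ne
                by (auto simp: insert_commute)
              show "sees E ?e u 0" using e' by (auto simp: sees_def)
              show "sees E ?e x 0" using seed dN by (auto intro: sees_upd)
              have n: "k \<noteq> 0 \<Longrightarrow> \<not> sees E ?e u k" "k \<noteq> 0 \<Longrightarrow> \<not> sees E ?e x k" for k
                using nseed dN vE by (auto simp: sees_upd_iff)
              show "\<not> sees E ?e u 2" "\<not> sees E ?e u 1" "\<not> sees E ?e x 2" "\<not> sees E ?e x 1"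
                by (simp_all add: n)
              have vu: "v \<notin> branch E u p" if "{u, p} \<in> E" "p \<noteq> v" for p
                using branch_unique[of u p v] that e by auto
              have vx: "v \<notin> branch E x p" if "{x, p} \<in> E" "p \<noteq> u" for p
                using sub_x[OF that, of v] vu[of x] e e' by auto
              have okge: "ok ?e u g1 k" "ok ?e u g2 k" for k
                using g okgd[of g1 k] okgd[of g2 k] vu[of g1] vu[of g2] by (auto intro: ok_upd)
              have okfe: "ok ?e x f1 k" "ok ?e x f2 k" for k
                using f okfd[of f1 k] okfd[of f2 k] vx[of f1] vx[of f2] by (auto intro: ok_upd)
              show "ok ?e u g1 1" "ok ?e u g1 2" "ok ?e u g2 1" by (rule okge)+
              show "ok ?e x f1 1" "ok ?e x f1 2" "ok ?e x f2 1" by (rule okfe)+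
            qed (use e' dN g f ne e in \<open>auto simp: tri_def\<close>)
            ultimately show ?thesis using bob_moves by blast
          next
            case True
            have "\<not> sees E ?c v 0" using nb[of v] far(3) wne(3) wu[of v] e
              branch_nbr[of u v w] ne wne by (auto simp: sees_def insert_commute)
            then have i0: "i = 0" using True mN by (auto simp: sees_upd_iff)
            \<comment> \<open>Alice has made \<open>v\<close> see 0, so \<open>g1\<close> takes 0
              instead. Now \<open>v\<close> replaces \<open>g1\<close> as a side branch of
              \<open>u\<close>; it may contain the spoiler, hence it is only claimed for a colour
              \<open>k\<close> absent from \<open>B\<close>.\<close>
            obtain k l where kl: "tri 0 k l" "\<forall>b\<in>B. c b \<noteq> Some k"
              using spoiler_colour[of 0 B c] B(1) by (metis zero_less_numeral)
            have okv: "ok ?d u v k"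
              using e dN kl i0 c by (auto simp: ok_def tri_def)
            let ?e = "?d(g1 := Some 0)"
            have gne: "g1 \<noteq> u" "g1 \<noteq> x" using edge_D(3)[of u g1] g by auto
            have gu: "g1 \<notin> branch E u p" if "{u, p} \<in> E" "p \<noteq> g1" for p
              using branch_unique[of u p g1] that g by auto
            have gx: "g1 \<notin> branch E x p" if "{x, p} \<in> E" "p \<noteq> u" for p
              using sub_x[OF that, of g1] gu[of x] g e' by auto
            have gE: "{x, g1} \<notin> E" using gx[of g1] gne by auto
            have gN: "?d g1 = None" using okgd[of g1 k] g by (auto simp: ok_def)
            have "legal_move V E 3 ?d g1 0" using ok_legal[OF okgd] g dN by auto
            moreover have "\<not> winsA ?e"
            proof (rule adjacent_pair[of u x ?e 0 k l g2 v f1 f2])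
              show "sees E ?e u 0" using g by (auto simp: sees_def insert_commute)
              show "sees E ?e x 0" using seed gN by (auto intro: sees_upd)
              have n: "k \<noteq> 0 \<Longrightarrow> \<not> sees E ?e u k" "k \<noteq> 0 \<Longrightarrow> \<not> sees E ?e x k" for k
                using nseed gN gE by (auto simp: sees_upd_iff insert_commute)
              show "\<not> sees E ?e u k" "\<not> sees E ?e u l" "\<not> sees E ?e x k" "\<not> sees E ?e x l"
                using kl by (auto simp: n tri_def)
              show "ok ?e u g2 k" "ok ?e u g2 l" "ok ?e u v k"
                using okgd[of g2] okv gu[of g2] gu[of v] g e by (auto intro: ok_upd)
              show "ok ?e x f1 k" "ok ?e x f1 l" "ok ?e x f2 k"
                using okfd[of f1] okfd[of f2] gx[of f1] gx[of f2] f by (auto intro: ok_upd)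
            qed (use e' dN g f ne e gne kl in auto)
            ultimately show ?thesis using bob_moves by blast
          qed
        next
          case 5
          obtain k l where kl: "tri 0 k l" "Some i \<noteq> Some k"
            using third_colour[of 0 "Some i"] by auto
          \<comment> \<open>This move makes two threats: \<open>x\<close> now sees 0 and
            \<open>k\<close>, and a trail starts from \<open>u\<close> through \<open>v\<close> and
            \<open>y\<close>. They lie on different sides of \<open>u\<close>. Since
            \<open>k\<close> differs from \<open>i\<close>, the move is legal even if Alice played
            next to \<open>u\<close>.\<close>
          let ?e = "?d(u := Some k)"
          have dN: "?d u = None" "?d x = None" using cN 5 by auto
          have "\<not> sees E ?d u k" using nsee_u kl mN by (auto simp: sees_upd_iff)
          then have lu: "legal_move V E 3 ?d u k"
            using dN kl edge_D[OF e(1)] by (auto simp: legal_move_def sees_def tri_def)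
          have seen: "sees E ?e x 0" "sees E ?e x k"
            using su[OF see_w] dN e' by (auto intro: sees_upd sees_new)
          have okfe: "ok ?e x f1 l \<or> ok ?e x f2 l"
          proof -
            have uf: "u \<notin> branch E x p" if "{x, p} \<in> E" "p \<noteq> u" for p
              using branch_unique[of x p u] that e by auto
            have "m \<notin> branch E x f1 \<or> m \<notin> branch E x f2"
              using branch_disjoint[of x f1 f2 m] f by auto
            then have "ok ?d x f1 l \<or> ok ?d x f2 l" using okf f okd by auto
            then show ?thesis using uf[of f1] uf[of f2] f ok_upd by auto
          qed
          have "\<not> winsA ?e"
          proof (rule alice_moves)
            show "x \<in> V" "?e x = None" using edge_D[OF e(1)] dN ne by auto
            fix m' i' assume lm': "legal_move V E 3 ?e m' i'"
            let ?g = "?e(m' := Some i')"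
            have mN': "?e m' = None" "m' \<noteq> u" using lm' by (auto simp: legal_move_def)
            show "\<not> winsB ?g"
            proof (cases "m' \<in> branch E u v")
              case True
              then have nx: "m' \<notin> branch E u x" using branch_disjoint[of u v x m'] e e' by auto
              then have "m' \<noteq> x" by auto
              obtain p where p: "p \<in> {f1, f2}" "ok ?e x p l" using okfe by blast
              then have "m' \<notin> branch E x p" using sub_x[of p m'] nx f by auto
              then have "ok ?g x p l" using p ok_upd by blast
              moreover have "sees E ?g x 0" "sees E ?g x k" using seen mN' by (auto intro: sees_upd)
              moreover have "?g x = None" using dN ne \<open>m' \<noteq> x\<close> by auto
              ultimately show ?thesis using finish_ok kl(1) by blast
            next
              case False
              have "\<forall>z\<in>branch E u v. z \<notin> B \<longrightarrow> ?g z = None"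
                using False 5 brv branch_root[of u v] e by auto
              then show ?thesis using chv e mN' kl B
                by (intro chain_wins_Bob[of B u v ?g k]) (auto simp: tri_def)
            qed
          qed
          then show ?thesis using lu bob_moves by blast
        qed
      qed
    qed
  qed
qed

end

text \<open>Cutting at the first occurrence of either end and appending the other end keeps the list
  simple, even if the path visits \<open>p'\<close> before \<open>p\<close>. This is why the order
  of the ends in the result is left open.\<close>

lemma extend_path:
  assumes "successively P xs" "distinct xs" "p \<in> set xs" "p \<noteq> p'" "P p p'" "P p' p"
  shows "\<exists>ys zs h h'. xs = ys @ h # zs \<and> {h, h'} = {p, p'} \<and> distinct (ys @ [h, h']) \<and>
    successively P (ys @ [h, h'])"
proof -
  obtain ys h zs where s: "xs = ys @ h # zs" "h \<in> {p, p'}" "\<forall>y\<in>set ys. y \<notin> {p, p'}"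
    using split_list_first_prop[of xs "\<lambda>y. y \<in> {p, p'}"] assms(3) by blast
  obtain h' where h': "{h, h'} = {p, p'}" "P h h'" "h \<noteq> h'"
    using s(2) assms(4-6) by (metis insert_iff singletonD insert_commute)
  have "successively P (ys @ [h])" using assms(1) s(1) 
    by (cases zs) (auto simp: successively_append_iff)
  then have "successively P (ys @ [h, h'])" using h'
    by (auto simp: successively_append_iff)
  moreover have "distinct (ys @ [h, h'])" using s h' assms(2) by auto
  ultimately show ?thesis using s(1) h'(1) by blast
qed

section \<open>From connecting paths to Bob's trails\<close>

context forest_no3
begin

text \<open>Links never join two small vertices, so after a big vertex the path either reaches its
  first big-big edge or passes through a single small vertex to another big one. Hence an induction
  that consumes two vertices at a time.\<close>

lemma chain_of_path:
  assumes "successively (\<lambda>x y. (x, y) \<in> link Y) (u # xs)" "distinct (u # xs)" "q \<notin> set xs"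
    and "big E u" "\<not> successively (\<lambda>x y. \<not> (big E x \<and> big E y)) (u # xs)"
    and "\<forall>x\<in>Y. big E x \<longrightarrow> far B x"
  shows "chain B q u"
  using assms
proof (induction xs arbitrary: u q rule: induct_list012)
  case 1
  then show ?case by simp
next
  case (2 s)
  then show ?case by (intro chain.base[of u s]) (auto simp: link_def)
next
  case (3 s u' xs)
  show ?case
  proof (cases "big E s")
    case True
    then show ?thesis using 3 by (intro chain.base[of u s]) (auto simp: link_def)
  next
    case False
    have "chain B s u'" using 3 False by (intro "3.IH"(1)) (auto simp: link_def)
    then show ?thesis using 3 False by (intro chain.step[of u B s q u']) (auto simp: link_def)
  qed
qed

text \<open>Lets a row of four big vertices be reversed when the vertex coloured first lies on the
  wrong side of its middle edge.\<close>

lemma branch_two_sides: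
  assumes "{u, v} \<in> E" "z \<in> branch E u v" shows "z \<notin> branch E v u"
proof -
  have "(v, z) \<in> (avoid E u)\<^sup>*" using assms by (simp add: branch_def)
  then show ?thesis
  proof (induction rule: rtrancl_induct)
    case base
    show ?case using branch_root[of v u] assms by (simp add: insert_commute)
  next
    case (step z z')
    show ?case
    proof
      assume z': "z' \<in> branch E v u"
      have e: "{z', z} \<in> E" "z' \<noteq> u" "{z, z'} \<in> E" using step by (auto simp: avoid_def insert_commute)
      show False
      proof (cases "z = v")
        case True
        then show ?thesis using branch_unique[of v u z'] e z' assms by (auto simp: insert_commute)
      next
        case False
        then show ?thesis using branch_step[of z' v u z] z' e step.IH edge_D[OF assms(1)] by auto
      qed
    qed
  qed
qed

text \<open>The vertex \<open>a\<close> is itself the coloured start of the trail, so there is no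
  spoiler and \<open>B\<close> is empty.\<close>

lemma Bob_wins_touched:
  assumes "{a, u} \<in> E" "big E u" "(u, p) \<in> (link (V - {a}))\<^sup>*"
    and "{p, p'} \<in> E" "big E p" "big E p'" "p \<noteq> a" "p' \<noteq> a" "k < 3"
  shows "\<not> winsB ((\<lambda>_. None)(a := Some k))"
proof -
  let ?Y = "V - {a}"
  let ?P = "\<lambda>x y. (x, y) \<in> link ?Y"
  obtain xs where xs: "xs \<noteq> []" "hd xs = u" "last xs = p" "distinct xs" "successively ?P xs"
    using rtrancl_simple_path[OF assms(3)] by blast
  have pp: "?P p p'" "?P p' p" "p \<noteq> p'"
    using assms edge_D[OF assms(4)] by (auto simp: link_def insert_commute)
  have "p \<in> set xs" using xs by auto
  then obtain ys zs h h' where e: "xs = ys @ h # zs" "{h, h'} = {p, p'}"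
    "distinct (ys @ [h, h'])" "successively ?P (ys @ [h, h'])"
    using extend_path[OF xs(5,4) _ pp(3,1,2)] by blast
  obtain t ts where t: "ys @ [h, h'] = t # ts" by (cases ys) auto
  have tu: "t = u" using xs(2) e(1) t by (cases ys) auto
  have hh: "big E h" "big E h'" "h \<in> ?Y" "h' \<in> ?Y"
    using e(2) assms edge_D[OF assms(4)] by (auto simp: doubleton_eq_iff)
  have "ys = [] \<or> set ys \<subseteq> ?Y"
  proof -
    have "set ys \<subseteq> ?Y" if "successively ?P (ys @ [h, h'])"
      using that by (induction ys rule: induct_list012) (auto simp: link_def)
    then show ?thesis using e by blast
  qed
  then have "a \<notin> set ts" using hh t by (cases ys) auto
  moreover have "\<not> successively (\<lambda>x y. \<not> (big E x \<and> big E y)) (ys @ [h, h'])"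
    using hh by (auto simp: successively_append_iff)
  ultimately have "chain {} a u"
    using e t tu assms by (intro chain_of_path[of ?Y u ts]) (auto simp: far_def)
  then show ?thesis
    using assms branch_root[of a u] by (intro chain_wins_Bob[of "{}" a u _ k]) auto
qed

text \<open>Extended at both ends, the path reads \<open>h'\<close>, \<open>h\<close>,
  \<open>M\<close>, \<open>g\<close>, \<open>g'\<close> with these four vertices big. Either its
  first four vertices are all big, which gives a row, or the third or fourth is small. Such a small
  vertex has a big-big edge right before it and the edge of \<open>g\<close> and \<open>g'\<close>
  further on, hence lies between two trails.\<close>

lemma Bob_wins_two_edges:
  assumes "{p, p'} \<in> E" "big E p" "big E p'" "{r, r'} \<in> E" "big E r" "big E r'"
    and disj: "{p, p'} \<inter> {r, r'} = {}" and con: "(p, r) \<in> (link Y)\<^sup>*"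
    and Y: "a \<notin> Y" "\<And>y. y \<in> Y \<Longrightarrow> big E y \<Longrightarrow> {a, y} \<notin> E" "p \<in> Y" "p' \<in> Y" "r \<in> Y" "r' \<in> Y"
    and "k < 3"
  shows "\<not> winsB ((\<lambda>_. None)(a := Some k))"
proof -
  let ?P = "\<lambda>x y. (x, y) \<in> link Y"
  let ?c = "(\<lambda>_. None)(a := Some k)"
  let ?B = "{a}"
  have far: "\<forall>x\<in>Y. big E x \<longrightarrow> far ?B x" using Y by (auto simp: far_def)
  obtain xs where xs: "xs \<noteq> []" "hd xs = p" "last xs = r" "distinct xs" "successively ?P xs"
    using rtrancl_simple_path[OF con] by blast
  have ends: "?P p p'" "?P p' p" "p \<noteq> p'" "?P r r'" "?P r' r" "r \<noteq> r'"
    using assms edge_D by (auto simp: link_def insert_commute)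
  have "r \<in> set xs" using xs by auto
  then obtain ys h h' where e: "hd (ys @ [h]) = p" "{h, h'} = {r, r'}"
    "distinct (ys @ [h, h'])" "successively ?P (ys @ [h, h'])"
    using extend_path[OF xs(5,4) _ ends(6,4,5)] xs(2) by (metis hd_append list.sel(1))
  have "p \<in> set (ys @ [h])" using e(1) by (metis hd_in_set snoc_eq_iff_butlast)
  then have "p \<in> set (rev (ys @ [h, h']))" by auto
  \<comment> \<open>Links are symmetric, so the path may be reversed and \<open>extend_path\<close>
    applied at its other end.\<close>
  moreover have "successively ?P (rev (ys @ [h, h']))"
    unfolding successively_rev using e(4) by (rule successively_mono) (auto intro: link_sym)
  ultimately obtain zs us g g' where f: "rev (ys @ [h, h']) = zs @ g # us" "{g, g'} = {p, p'}"
    "distinct (zs @ [g, g'])" "successively ?P (zs @ [g, g'])"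
    using extend_path[of ?P "rev (ys @ [h, h'])" p p'] e(3) ends by (metis distinct_rev)
  have hg: "g \<notin> {h, h'}" "g' \<notin> {h, h'}" using e(2) f(2) disj by auto
  have bigs: "big E h" "big E h'" "big E g" "big E g'"
    using e(2) f(2) assms by (auto simp: doubleton_eq_iff)
  have nb: "\<not> successively (\<lambda>x y. \<not> (big E x \<and> big E y)) (M @ [g, g'])" for M
    using bigs by (auto simp: successively_append_iff)
  \<comment> \<open>The reversed path begins with \<open>h'\<close> and \<open>h\<close>. Both
    differ from \<open>g\<close> because the two edges are disjoint, so the cut comes after
    them.\<close>
  obtain M where M: "zs = h' # h # M"
    using f(1) hg by (cases zs; cases "tl zs") auto
  then have L: "distinct (h' # h # M @ [g, g'])" "successively ?P (h' # h # M @ [g, g'])" using f by auto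
  have U: "x = y" if "x \<in> ?B" "y \<in> ?B" for x y :: 'a using that by simp
  have row: "\<not> winsB ?c"
    if "?P x1 x2" "?P x2 x3" "?P x3 x4" "distinct [x1, x2, x3, x4]"
      "big E x1" "big E x2" "big E x3" "big E x4" for x1 x2 x3 x4
  proof (cases "a \<in> branch E x3 x2")
    case False
    then show ?thesis using that far
      by (intro four_big_in_row[of x1 x2 x3 x4 ?B]) (auto simp: link_def)
  next
    case True
    then have "a \<notin> branch E x2 x3" using branch_two_sides[of x2 x3 a] that by (auto simp: link_def)
    then show ?thesis using that far
      by (intro four_big_in_row[of x4 x3 x2 x1 ?B]) (auto simp: link_def insert_commute)
  qed
  have mid: "\<not> winsB ?c"
    if "?P x0 x1" "?P x1 s" "?P s x2" "distinct (x0 # x1 # s # x2 # N)" "\<not> big E s" "big E x0"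
      "x2 # N = M' @ [g, g']" "successively ?P (x2 # N)" for x0 x1 s x2 N M'
  proof (rule small_between_chains[of s x1 x2 ?B])
    have nb': "\<not> successively (\<lambda>x y. \<not> (big E x \<and> big E y)) (x2 # N)"
      using nb[of M'] that(7) by argo
    show "chain ?B s x1" using that far 
      by (intro chain.base[of x1 x0]) (auto simp: link_def insert_commute)
    show "chain ?B s x2" using that(1-6,8) far nb'
      by (intro chain_of_path[of Y x2 N]) (auto simp: link_def)
  qed (use that(1-6) in \<open>auto simp: link_def insert_commute\<close>)
  show ?thesis
  proof (cases M)
    case Nil
    then show ?thesis using L bigs by (intro row[of h' h g g']) auto
  next
    case (Cons s N)
    obtain x2 N2 where N: "N @ [g, g'] = x2 # N2" by (cases N) auto
    have L2: "distinct (h' # h # s # x2 # N2)" "successively ?P (h' # h # s # x2 # N2)"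
      using L Cons N by auto
    show ?thesis
    proof (cases "big E s")
      case False
      have a: "?P h' h" "?P h s" "?P s x2" "successively ?P (x2 # N2)" using L2(2) by auto
      show ?thesis by (rule mid[OF a(1-3) L2(1) False bigs(2) N[symmetric] a(4)])
    next
      case s: True
      show ?thesis
      proof (cases "big E x2")
        case True
        then show ?thesis using L2 bigs s by (intro row[of h' h s x2]) auto
      next
        case False
        then obtain N' where N': "N = x2 # N'" using N bigs by (cases N) auto
        obtain x3 N3 where N3: "N' @ [g, g'] = x3 # N3" by (cases N') auto
        then have N2: "N2 = x3 # N3" using N N' by simp
        have a: "?P h s" "?P s x2" "?P x2 x3" "successively ?P (x3 # N3)"
          "distinct (h # s # x2 # x3 # N3)" using L2 N2 by auto
        show ?thesis by (rule mid[OF a(1-3,5) False bigs(1) N3[symmetric] a(4)])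
      qed
    qed
  qed
qed

end

section \<open>Trunks after the first move\<close>

definition adj :: "'b set set \<Rightarrow> ('b \<times> 'b) set" where
  "adj D = {(u, w). {u, w} \<in> D}"

lemma adj_rtrancl_sym: "(x, y) \<in> (adj D)\<^sup>* \<Longrightarrow> (y, x) \<in> (adj D)\<^sup>*"
proof -
  have "sym (adj D)" by (auto simp: sym_def adj_def insert_commute)
  then show "(x, y) \<in> (adj D)\<^sup>* \<Longrightarrow> (y, x) \<in> (adj D)\<^sup>*" by (auto dest: sym_rtrancl symD)
qed

lemma connected_sgI:
  assumes "x \<in> W" "\<And>e. e \<in> D \<Longrightarrow> e \<subseteq> W" "\<And>y. y \<in> W \<Longrightarrow> (x, y) \<in> (adj D)\<^sup>*"
  shows "connected_sg W D"
  unfolding connected_sg_def adj_def[symmetric]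
proof (intro conjI ballI)
  fix y z assume "y \<in> W" "z \<in> W"
  then show "(y, z) \<in> (adj D)\<^sup>*"
    using rtrancl_trans[OF adj_rtrancl_sym[OF assms(3)] assms(3)] by simp
next
  show "W \<noteq> {}" using assms(1) by blast
  show "e \<subseteq> W" if "e \<in> D" for e using that by (rule assms(2))
qed

lemma connected_sgD:
  assumes "connected_sg W D"
  shows "W \<noteq> {}" "\<And>e. e \<in> D \<Longrightarrow> e \<subseteq> W" "\<And>x y. x \<in> W \<Longrightarrow> y \<in> W \<Longrightarrow> (x, y) \<in> (adj D)\<^sup>*"
  using assms unfolding connected_sg_def adj_def by simp_all

lemma deg_one_unique:
  assumes "deg D a = 1" "{a, x} \<in> D" "{a, y} \<in> D" shows "x = y"
proof -
  obtain e where "{e \<in> D. a \<in> e} = {e}" using assms(1) unfolding deg_def by (metis card_1_singletonE)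
  moreover have "{a, x} \<in> {e \<in> D. a \<in> e}" "{a, y} \<in> {e \<in> D. a \<in> e}" using assms by simp_all
  ultimately have "{a, x} = {a, y}" by simp
  then show ?thesis by (metis doubleton_eq_iff)
qed

locale coloured_root = forest_graph +
  fixes a
  assumes aV: "a \<in> V"
begin

text \<open>The trunk through \<open>x\<close> when only \<open>a\<close> is coloured.\<close>

definition tr :: "'a \<Rightarrow> 'a set \<times> 'a set set" where
  "tr x = (let W = branch E a x \<union> {y. y = a \<and> (\<exists>z\<in>branch E a x. {a, z} \<in> E)} in (W, {e \<in> E. e \<subseteq> W}))"

lemma fst_tr: "fst (tr x) = branch E a x \<union> {y. y = a \<and> (\<exists>z\<in>branch E a x. {a, z} \<in> E)}"
  by (simp add: tr_def Let_def)

lemma snd_tr: "snd (tr x) = {e \<in> E. e \<subseteq> fst (tr x)}"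
  by (simp add: tr_def Let_def)

lemma tr_edge:
  assumes "y \<in> fst (tr x)" "y \<noteq> a" "{y, z} \<in> E" "x \<noteq> a"
  shows "{y, z} \<in> snd (tr x)"
proof -
  have y: "y \<in> branch E a x" using assms by (simp add: fst_tr)
  have "z \<in> fst (tr x)"
  proof (cases "z = a")
    case True
    then have "\<exists>w\<in>branch E a x. {a, w} \<in> E" using y assms by (auto simp: insert_commute)
    then show ?thesis using True by (simp add: fst_tr)
  next
    case False
    then show ?thesis using branch_step[OF y assms(4,3)] by (simp add: fst_tr)
  qed
  then show ?thesis using assms by (simp add: snd_tr)
qed

lemma branch_in_V:
  assumes "y \<in> branch E q x" "x \<in> V" shows "y \<in> V"
proof -
  have "(x, y) \<in> (avoid E q)\<^sup>*" using assms by (simp add: branch_def)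
  then show ?thesis
  proof (cases rule: rtranclE)
    case (step z)
    then have "{z, y} \<in> E" by (simp add: avoid_def)
    then show ?thesis by (rule edge_D)
  qed (use assms in simp)
qed

lemma tr_nbr:
  assumes "x \<noteq> a" "{a, y} \<in> snd (tr x)"
  shows "y \<in> branch E a x" "{a, y} \<in> E"
proof -
  show "{a, y} \<in> E" using assms by (simp add: snd_tr)
  then have "y \<noteq> a" using edge_D by blast
  then show "y \<in> branch E a x" using assms by (simp add: snd_tr fst_tr)
qed

text \<open>The leaf condition at \<open>a\<close> is automatic: two edges at \<open>a\<close>
  inside \<open>tr x\<close> would lead to two neighbours of \<open>a\<close> in one branch.\<close>

lemma trunk_cond_tr:
  assumes "x \<in> V" "x \<noteq> a"
  shows "trunk_cond V E {a} (fst (tr x)) (snd (tr x))"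
  unfolding trunk_cond_def
proof (intro conjI)
  have "branch E a x \<subseteq> V" using branch_in_V assms by blast
  then show "fst (tr x) \<subseteq> V" using aV by (auto simp: fst_tr)
  show "snd (tr x) \<subseteq> E" by (auto simp: snd_tr)
  have b: "(x, y) \<in> (adj (snd (tr x)))\<^sup>*" if "y \<in> branch E a x" for y
  proof -
    have "(x, y) \<in> (avoid E a)\<^sup>*" using that by (simp add: branch_def)
    then show ?thesis
    proof (induction rule: rtrancl_induct)
      case (step y z)
      then have "y \<in> branch E a x" by (simp add: branch_def)
      then have "{y, z} \<in> snd (tr x)"
        using tr_edge[of y x z] step assms by (auto simp: fst_tr avoid_def)
      then show ?case using step by (auto intro: rtrancl_into_rtrancl simp: adj_def)
    qed simp
  qed
  show "connected_sg (fst (tr x)) (snd (tr x))"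
  proof (rule connected_sgI[of x])
    show "x \<in> fst (tr x)" by (simp add: fst_tr)
    show "e \<subseteq> fst (tr x)" if "e \<in> snd (tr x)" for e using that by (simp add: snd_tr)
    fix y assume y: "y \<in> fst (tr x)"
    show "(x, y) \<in> (adj (snd (tr x)))\<^sup>*"
    proof (cases "y \<in> branch E a x")
      case False
      then obtain z where z: "y = a" "z \<in> branch E a x" "{a, z} \<in> E" using y by (auto simp: fst_tr)
      then have "{z, a} \<in> snd (tr x)"
        using tr_edge[of z x a] branch_ne[of z a x] assms by (auto simp: fst_tr insert_commute)
      then show ?thesis using b[OF z(2)] z(1) by (auto intro: rtrancl_into_rtrancl simp: adj_def)
    qed (use b in auto)
  qed
  show "\<forall>c\<in>fst (tr x) \<inter> {a}. deg (snd (tr x)) c = 1"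
  proof
    fix c assume c: "c \<in> fst (tr x) \<inter> {a}"
    then have "a \<notin> branch E a x" using branch_ne[of a a x] assms by auto
    then obtain z where z: "z \<in> branch E a x" "{a, z} \<in> E" using c by (auto simp: fst_tr)
    have az: "{a, z} \<in> snd (tr x)"
      using tr_edge[of z x a] branch_ne[of z a x] z assms by (auto simp: fst_tr insert_commute)
    have "e = {a, z}" if e: "e \<in> snd (tr x)" "a \<in> e" for e
    proof -
      have "e \<in> E" using e by (simp add: snd_tr)
      then obtain y where y: "e = {a, y}" using e(2) by (elim edge_obtain) auto
      then have "y \<in> branch E a x" "{a, y} \<in> E" using tr_nbr assms e by auto
      then have "y = z" using nbrs_not_connected[of a y z] z
          branch_sym[of y a x] unfolding branch_def by (metis mem_Collect_eq rtrancl_trans)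
      then show ?thesis using y by simp
    qed
    then have "{e \<in> snd (tr x). a \<in> e} = {{a, z}}" using az by blast
    then show "deg (snd (tr x)) c = 1" using c by (simp add: deg_def)
  qed
qed

text \<open>Maximality: all edges at uncoloured vertices of \<open>tr x\<close> are already present,
  so a larger candidate could grow only through \<open>a\<close>, which is a leaf and has its one
  edge inside.\<close>

lemma trunk_tr:
  assumes "x \<in> V" "x \<noteq> a"
  shows "trunk V E {a} (tr x)"
  unfolding trunk_def
proof (intro conjI allI impI)
  let ?W = "fst (tr x)" and ?D = "snd (tr x)"
  show "trunk_cond V E {a} ?W ?D" using trunk_cond_tr assms by blast
  fix W' D' assume "trunk_cond V E {a} W' D' \<and> ?W \<subseteq> W' \<and> ?D \<subseteq> D'"
  then have t: "W' \<subseteq> V" "D' \<subseteq> E" "connected_sg W' D'" "a \<in> W' \<Longrightarrow> deg D' a = 1"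
    and sub: "?W \<subseteq> W'" "?D \<subseteq> D'" by (auto simp: trunk_cond_def)
  have "z \<in> ?W" if "z \<in> W'" for z
  proof -
    have "x \<in> W'" using sub by (auto simp: fst_tr)
    then have "(x, z) \<in> (adj D')\<^sup>*" using connected_sgD(3)[OF t(3)] that by blast
    then show ?thesis
    proof (induction rule: rtrancl_induct)
      case base
      show ?case by (simp add: fst_tr)
    next
      case (step y z)
      have yz: "{y, z} \<in> D'" using step by (simp add: adj_def)
      show ?case
      proof (cases "y = a")
        case False
        then have "{y, z} \<in> ?D" using tr_edge[of y x z] step yz t assms by auto
        then show ?thesis by (simp add: snd_tr)
      next
        case True
        have "a \<notin> branch E a x" using branch_ne[of a a x] assms by auto
        then obtain w where w: "w \<in> branch E a x" "{a, w} \<in> E" using True step by (auto simp: fst_tr)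
        then have "{a, w} \<in> ?D"
          using tr_edge[of w x a] branch_ne[of w a x] assms by (auto simp: fst_tr insert_commute)
        then have "{a, w} \<in> D'" using sub by blast
        moreover have "deg D' a = 1" using t True step sub by blast
        ultimately have "z = w" using deg_one_unique yz True by metis
        then show ?thesis using w by (simp add: fst_tr)
      qed
    qed
  qed
  then show "W' = ?W" using sub by blast
  then have "D' \<subseteq> ?D" using t(2) connected_sgD(2)[OF t(3)] unfolding snd_tr by blast
  then show "D' = ?D" using sub by blast
qed

text \<open>A walk inside \<open>T\<close> from \<open>x\<close> cannot pass through
  \<open>a\<close>, a leaf of \<open>T\<close>, so \<open>T\<close> stays within
  \<open>tr x\<close>, and maximality of \<open>T\<close> gives equality. Hence any uncoloured
  vertex determines its trunk.\<close>

lemma trunk_eq_tr: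
  assumes T: "trunk V E {a} T" and x: "x \<in> fst T" "x \<noteq> a"
  shows "T = tr x" "x \<in> V"
proof -
  let ?W = "fst T" and ?D = "snd T"
  have t: "?W \<subseteq> V" "?D \<subseteq> E" "connected_sg ?W ?D" "a \<in> ?W \<Longrightarrow> deg ?D a = 1"
    using T by (auto simp: trunk_def trunk_cond_def)
  show xV: "x \<in> V" using t x by blast
  have inv: "z \<in> branch E a x \<or> z = a \<and> (\<exists>y\<in>branch E a x. {y, a} \<in> ?D)" if "z \<in> ?W" for z
  proof -
    have "(x, z) \<in> (adj ?D)\<^sup>*" using connected_sgD(3)[OF t(3)] that x by blast
    then show ?thesis
    proof (induction rule: rtrancl_induct)
      case (step y z)
      have yz: "{y, z} \<in> ?D" using step by (simp add: adj_def)
      show ?case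
      proof (cases "y \<in> branch E a x")
        case True
        then show ?thesis using branch_step[OF True x(2), of z] yz t by blast
      next
        case False
        then obtain w where w: "y = a" "w \<in> branch E a x" "{w, a} \<in> ?D" using step by blast
        have "a \<in> ?W" using connected_sgD(2)[OF t(3) w(3)] by simp
        then have "z = w" using deg_one_unique[of ?D a z w] t(4) yz w by (simp add: insert_commute)
        then show ?thesis using w by simp
      qed
    qed simp
  qed
  have sub: "?W \<subseteq> fst (tr x)"
  proof
    fix z assume "z \<in> ?W"
    from inv[OF this] show "z \<in> fst (tr x)"
    proof
      assume "z = a \<and> (\<exists>y\<in>branch E a x. {y, a} \<in> ?D)"
      then obtain y where "z = a" "y \<in> branch E a x" "{a, y} \<in> E" using t by (auto simp: insert_commute)
      then show ?thesis by (auto simp: fst_tr)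
    qed (simp add: fst_tr)
  qed
  have "?D \<subseteq> snd (tr x)"
  proof
    fix e assume e: "e \<in> ?D"
    then have "e \<subseteq> ?W" using connected_sgD(2)[OF t(3)] by blast
    then show "e \<in> snd (tr x)" using sub t e by (auto simp: snd_tr)
  qed
  then have "fst (tr x) = ?W \<and> snd (tr x) = ?D"
    using T sub trunk_cond_tr[OF xV x(2)] by (auto simp: trunk_def)
  then show "T = tr x" by (metis prod.collapse)
qed

lemma trunk_edge:
  assumes "trunk V E {a} T" "y \<in> fst T" "y \<noteq> a" "{y, z} \<in> E"
  shows "{y, z} \<in> snd T" "z \<in> fst T"
proof -
  have T: "T = tr y" using trunk_eq_tr assms by blast
  then show "{y, z} \<in> snd T" using tr_edge[of y y z] assms by simp
  then show "z \<in> fst T" using T by (simp add: snd_tr)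
qed

lemma trunk_facts:
  assumes "trunk V E {a} T"
  shows "fst T \<subseteq> V" "snd T \<subseteq> E" "\<And>e. e \<in> snd T \<Longrightarrow> e \<subseteq> fst T" "a \<in> fst T \<Longrightarrow> deg (snd T) a = 1"
  using assms unfolding trunk_def trunk_cond_def connected_sg_def by simp_all

section \<open>Edges and degrees in the disjoint union of trunks\<close>

abbreviation "RV \<equiv> R_V V E {a}"
abbreviation "RE \<equiv> R_E V E {a}"
abbreviation "RC \<equiv> R_C V E {a}"
abbreviation "RE' \<equiv> R'_E V E {a}"

lemma RE_obtain:
  assumes "e \<in> RE" obtains T u v where "e = {(T, u), (T, v)}" "trunk V E {a} T" "{u, v} \<in> snd T"
  using assms unfolding R_E_def mem_Collect_eq by (elim exE conjE) (rule that)

lemma RE_at: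
  assumes "e \<in> RE" "(T, v) \<in> e"
  obtains w where "e = {(T, v), (T, w)}" "trunk V E {a} T" "{v, w} \<in> snd T"
proof -
  obtain S p q where e: "e = {(S, p), (S, q)}" "trunk V E {a} S" "{p, q} \<in> snd S"
    using assms(1) by (rule RE_obtain)
  then consider "S = T" "p = v" | "S = T" "q = v" using assms(2) by blast
  then show ?thesis
  proof cases
    case 1
    then show ?thesis using that[of q] e by simp
  next
    case 2
    then show ?thesis using that[of p] e by (simp add: insert_commute)
  qed
qed

lemma RE_iff: "{(T, u), (T', v)} \<in> RE \<longleftrightarrow> T = T' \<and> trunk V E {a} T \<and> {u, v} \<in> snd T"
proof
  assume "{(T, u), (T', v)} \<in> RE"
  then obtain w where "{(T, u), (T', v)} = {(T, u), (T, w)}" "trunk V E {a} T" "{u, w} \<in> snd T"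
    by (rule RE_at) auto
  then show "T = T' \<and> trunk V E {a} T \<and> {u, v} \<in> snd T" by (auto simp: doubleton_eq_iff)
next
  assume "T = T' \<and> trunk V E {a} T \<and> {u, v} \<in> snd T"
  then show "{(T, u), (T', v)} \<in> RE" unfolding R_E_def by blast
qed

lemma deg_RE:
  assumes "trunk V E {a} T" shows "deg RE (T, v) = deg (snd T) v"
proof -
  have "{e \<in> RE. (T, v) \<in> e} = (\<lambda>e. Pair T ` e) ` {e \<in> snd T. v \<in> e}"
  proof (intro equalityI subsetI)
    fix e assume "e \<in> {e \<in> RE. (T, v) \<in> e}"
    then obtain w where "e = {(T, v), (T, w)}" "{v, w} \<in> snd T" by (auto elim: RE_at)
    then show "e \<in> (\<lambda>e. Pair T ` e) ` {e \<in> snd T. v \<in> e}" by (intro image_eqI[of _ _ "{v, w}"]) auto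
  next
    fix e assume "e \<in> (\<lambda>e. Pair T ` e) ` {e \<in> snd T. v \<in> e}"
    then obtain d where d: "d \<in> snd T" "v \<in> d" "e = Pair T ` d" by auto
    then have "d \<in> E" using trunk_facts(2)[OF assms] by blast
    then obtain w where "d = {v, w}" using d(2) by (elim edge_obtain) auto
    then show "e \<in> {e \<in> RE. (T, v) \<in> e}" using d assms by (auto simp: RE_iff)
  qed
  moreover have "inj (\<lambda>e. Pair T ` e)" by (rule injI) (simp add: inj_image_eq_iff inj_on_def)
  then have "inj_on (\<lambda>e. Pair T ` e) {e \<in> snd T. v \<in> e}" by (rule inj_on_subset) simp
  ultimately show ?thesis unfolding deg_def by (simp only: card_image)
qed

lemma deg_trunk:
  assumes "trunk V E {a} T" "v \<in> fst T" "v \<noteq> a" shows "deg (snd T) v = deg E v"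
proof -
  have "{e \<in> snd T. v \<in> e} = {e \<in> E. v \<in> e}"
  proof safe
    fix e assume "e \<in> E" "v \<in> e"
    then obtain w where "e = {v, w}" by (elim edge_obtain) auto
    then show "e \<in> snd T" using trunk_edge assms \<open>e \<in> E\<close> by blast
  qed (use trunk_facts[OF assms(1)] in auto)
  then show ?thesis by (simp add: deg_def)
qed

text \<open>An uncoloured vertex keeps all its edges in its trunk, while each copy of
  \<open>a\<close> is a leaf and hence not big there, whatever the degree of \<open>a\<close> in the
  forest.\<close>

lemma big_RE:
  assumes "trunk V E {a} T" "v \<in> fst T"
  shows "2 < deg RE (T, v) \<longleftrightarrow> v \<noteq> a \<and> big E v"
proof (cases "v = a")
  case True
  then show ?thesis using assms deg_RE[OF assms(1), of a] trunk_facts(4)[OF assms(1)] by simp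
next
  case False
  then show ?thesis
    using deg_RE[OF assms(1), of v] deg_trunk[OF assms False] by (simp add: big_def)
qed

lemma RE'_iff: "{(T, u), (T', v)} \<in> RE' \<longleftrightarrow>
  T = T' \<and> trunk V E {a} T \<and> {u, v} \<in> snd T \<and> (u \<noteq> a \<and> big E u \<or> v \<noteq> a \<and> big E v)"
proof -
  have *: "{(T, u), (T', v)} \<in> RE' \<longleftrightarrow>
    {(T, u), (T', v)} \<in> RE \<and> (2 < deg RE (T, u) \<or> 2 < deg RE (T', v))"
    by (simp add: R'_E_def E_gt2_def)
  show ?thesis
  proof (cases "T = T' \<and> trunk V E {a} T \<and> {u, v} \<in> snd T")
    case True
    then have "u \<in> fst T" "v \<in> fst T" using trunk_facts(3)[of T "{u, v}"] by auto
    then show ?thesis using True big_RE[of T u] big_RE[of T v] unfolding * RE_iff by blast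
  next
    case False
    then show ?thesis unfolding * RE_iff by blast
  qed
qed

lemma RE'_sub: "RE' \<subseteq> RE"
  unfolding R'_E_def E_gt2_def by (rule Collect_restrict)

lemma RV_iff: "(T, v) \<in> RV \<longleftrightarrow> trunk V E {a} T \<and> v \<in> fst T"
  by (simp add: R_V_def)

lemma RC_iff: "(T, v) \<in> RC \<longleftrightarrow> (T, v) \<in> RV \<and> v = a"
  by (simp add: R_C_def)

lemma fin_RE_at: "finite {e \<in> RE. p \<in> e}"
proof -
  have "finite RV"
  proof (rule finite_subset)
    show "RV \<subseteq> (Pow V \<times> Pow E) \<times> V"
    proof
      fix q assume "q \<in> RV"
      then obtain T v where q: "q = (T, v)" "trunk V E {a} T" "v \<in> fst T"
        by (cases q) (simp add: RV_iff)
      then have "T \<in> Pow V \<times> Pow E" using trunk_facts(1,2)[of T] by (simp add: mem_Times_iff)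
      then show "q \<in> (Pow V \<times> Pow E) \<times> V" using q trunk_facts(1)[of T] by auto
    qed
  qed (use fin_V fin_E in auto)
  moreover have "RE \<subseteq> Pow RV"
  proof
    fix e assume "e \<in> RE"
    then obtain T u v where e: "e = {(T, u), (T, v)}" "trunk V E {a} T" "{u, v} \<in> snd T"
      by (rule RE_obtain)
    then show "e \<in> Pow RV" using trunk_facts(3)[OF e(2,3)] by (simp add: RV_iff)
  qed
  ultimately show ?thesis by (auto intro: finite_subset)
qed

text \<open>\<open>E_ggt2\<close> measures degrees in the reduced graph or in one of its trunks.
  Together with \<open>big_sup_RE\<close> this reduces both notions to \<open>big\<close> in the
  forest.\<close>

lemma big_sub_RE:
  assumes "D \<subseteq> RE" "2 < deg D (T, v)"
  shows "v \<noteq> a" "big E v"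
proof -
  have "{e \<in> D. (T, v) \<in> e} \<noteq> {}" using assms(2) unfolding deg_def by (metis card.empty not_less_zero)
  then obtain e where "e \<in> RE" "(T, v) \<in> e" using assms by blast
  then obtain w where w: "e = {(T, v), (T, w)}" "trunk V E {a} T" "{v, w} \<in> snd T" by (rule RE_at)
  have T: "trunk V E {a} T" "v \<in> fst T" using w trunk_facts(3)[OF w(2,3)] by simp_all
  have "deg D (T, v) \<le> deg RE (T, v)"
    unfolding deg_def using assms(1) by (intro card_mono fin_RE_at) auto
  then show "v \<noteq> a" "big E v" using big_RE[OF T] assms(2) by auto
qed

text \<open>Reduction deletes only edges between small vertices, so a big vertex still has all its
  edges in the reduced graph, and a \<open>D\<close> that keeps those also keeps its degree.\<close>

lemma big_sup_RE:
  assumes "trunk V E {a} T" "v \<in> fst T" "v \<noteq> a" "big E v" "D \<subseteq> RE" "\<And>e. e \<in> RE' \<Longrightarrow> (T, v) \<in> e \<Longrightarrow> e \<in> D"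
  shows "2 < deg D (T, v)"
proof -
  have "e \<in> D" if e: "e \<in> RE" "(T, v) \<in> e" for e
  proof -
    obtain w where "e = {(T, v), (T, w)}" "trunk V E {a} T" "{v, w} \<in> snd T"
      using e by (rule RE_at)
    then have "e \<in> RE'" using assms(1,3,4) by (simp add: RE'_iff)
    then show ?thesis using assms(6) e by simp
  qed
  then have "{e \<in> D. (T, v) \<in> e} = {e \<in> RE. (T, v) \<in> e}" using assms(5) by blast
  then show ?thesis using big_RE[OF assms(1,2)] assms(3,4) by (simp add: deg_def)
qed

section \<open>From the condition on trunks to positions of the game\<close>

definition root_cond :: bool where
  "root_cond \<longleftrightarrow> (\<forall>T. trunk RV RE' RC T \<longrightarrow>
    (card (fst T \<inter> RC) = 1 \<and> snd T \<inter> E_ggt2 RE' = {})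
    \<or> (fst T \<inter> RC = {} \<and> (\<exists>v\<in>fst T. covers v (E_ggt2 (snd T)))))"

text \<open>Coloured copies have degree 1 before the reduction, hence at most 1 in a component
  afterwards. Starting from an uncoloured \<open>x\<close> excludes degree 0, so the whole component
  meets the leaf condition and is a trunk.\<close>

lemma trunk_component:
  assumes "trunk V E {a} T" "x \<in> fst T" "x \<noteq> a"
  defines "W \<equiv> {p. ((T, x), p) \<in> (adj RE')\<^sup>*}" and "D \<equiv> {e \<in> RE'. e \<subseteq> {p. ((T, x), p) \<in> (adj RE')\<^sup>*}}"
  shows "trunk RV RE' RC (W, D)"
proof -
  let ?p = "(T, x)"
  have pW: "?p \<in> W" by (simp add: W_def)
  have step: "q \<in> W" if "p \<in> W" "{p, q} \<in> RE'" for p q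
    using that unfolding W_def by (auto intro: rtrancl_into_rtrancl simp: adj_def)
  have D: "D = {e \<in> RE'. e \<subseteq> W}" by (simp add: D_def W_def)
  have WRV: "W \<subseteq> RV"
  proof
    fix q assume "q \<in> W"
    then have "(?p, q) \<in> (adj RE')\<^sup>*" by (simp add: W_def)
    then show "q \<in> RV"
    proof (cases rule: rtranclE)
      case base
      then show ?thesis using assms(1,2) by (auto simp: RV_iff)
    next
      case (step y)
      then show ?thesis
        by (cases y; cases q) (auto simp: adj_def RE'_iff RV_iff dest: trunk_facts(3))
    qed
  qed
  have reach: "(?p, q) \<in> (adj D)\<^sup>*" if "q \<in> W" for q
  proof -
    have "(?p, q) \<in> (adj RE')\<^sup>*" using that by (simp add: W_def)
    then show ?thesis
    proof (induction rule: rtrancl_induct)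
      case (step y z)
      have "y \<in> W" using step by (simp add: W_def)
      moreover have "{y, z} \<in> RE'" using step by (simp add: adj_def)
      ultimately have "{y, z} \<in> D" using step.hyps \<open>\<And>p q. p \<in> W \<Longrightarrow> {p, q} \<in> RE' \<Longrightarrow> q \<in> W\<close>
        by (auto simp: D)
      then show ?case using step by (auto intro: rtrancl_into_rtrancl simp: adj_def)
    qed simp
  qed
  have degc: "deg D q = 1" if q: "q \<in> W \<inter> RC" for q
  proof -
    obtain S where S: "q = (S, a)" "trunk V E {a} S" "a \<in> fst S"
      using q by (cases q) (auto simp: RC_iff RV_iff)
    have "(?p, q) \<in> (adj D)\<^sup>*" "?p \<noteq> q" using q reach S assms(3) by auto
    then obtain y where "(y, q) \<in> adj D" by (metis rtranclE)
    then have "{e \<in> D. q \<in> e} \<noteq> {}" by (auto simp: adj_def)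
    moreover have fin: "finite {e \<in> D. q \<in> e}"
      using RE'_sub by (rule_tac finite_subset[OF _ fin_RE_at[of q]]) (auto simp: D)
    ultimately have "deg D q \<noteq> 0" by (simp add: deg_def)
    moreover have "deg D q \<le> deg RE q"
      unfolding deg_def using RE'_sub by (intro card_mono fin_RE_at) (auto simp: D)
    moreover have "deg RE q = 1" using S deg_RE[OF S(2)] trunk_facts(4)[OF S(2)] by simp
    ultimately show ?thesis by simp
  qed
  have con: "connected_sg W D"
    using pW reach by (intro connected_sgI[of ?p]) (auto simp: D)
  have maxi: "W' = W \<and> D' = D"
    if t: "trunk_cond RV RE' RC W' D'" "W \<subseteq> W'" "D \<subseteq> D'" for W' D'
  proof -
    have "W' \<subseteq> W"
    proof
      fix q assume "q \<in> W'"
      have c: "connected_sg W' D'" "D' \<subseteq> RE'" using t(1) by (simp_all add: trunk_cond_def)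
      have "?p \<in> W'" using pW t(2) by blast
      then have "(?p, q) \<in> (adj D')\<^sup>*" using connected_sgD(3)[OF c(1)] \<open>q \<in> W'\<close> by simp
      moreover have "adj D' \<subseteq> adj RE'" using c(2) unfolding adj_def by blast
      ultimately have "(?p, q) \<in> (adj RE')\<^sup>*" using rtrancl_mono by blast
      then show "q \<in> W" by (simp add: W_def)
    qed
    then have "W' = W" using t by blast
    moreover have "D' \<subseteq> D"
    proof
      fix e assume e: "e \<in> D'"
      have c: "connected_sg W' D'" "D' \<subseteq> RE'" using t(1) by (simp_all add: trunk_cond_def)
      show "e \<in> D" using connected_sgD(2)[OF c(1) e] c(2) e \<open>W' = W\<close> unfolding D by blast
    qed
    ultimately show ?thesis using t by blast
  qed
  have "trunk_cond RV RE' RC W D"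
    using WRV con degc by (auto simp: trunk_cond_def D)
  then show ?thesis using maxi by (auto simp: trunk_def)
qed

text \<open>Pairing with \<open>T\<close> embeds each component of uncoloured vertices in one trunk
  of the reduced graph. Alternative (i) becomes the first half of \<open>good\<close>, with
  \<open>a\<close> as the only toucher, and (ii) the second. The colour 0 is an arbitrary
  choice.\<close>

lemma root_cond_imp_inv:
  assumes root_cond
  shows "inv ((\<lambda>_. None)(a := Some 0))"
proof -
  let ?c = "(\<lambda>_. None)(a := Some (0::nat))"
  have "good ?c (comp ?c x)" if x: "x \<noteq> a" for x
  proof (cases "x \<in> V")
    case False
    \<comment> \<open>\<open>inv\<close> quantifies over the whole type. An element outside
      \<open>V\<close> meets no edge, so its component is a singleton without big vertices.\<close>
    have "y = x" if "y \<in> comp ?c x" for y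
    proof -
      have "(x, y) \<in> (link {z. ?c z = None})\<^sup>*" using that by (simp add: comp_def)
      then show ?thesis
        by (induction rule: rtrancl_induct) (use False in \<open>auto simp: link_def dest: edge_D\<close>)
    qed
    then have "\<not> big E y" if "y \<in> comp ?c x" for y using False big_in_V that by blast
    then have "no_bb (comp ?c x)" "one_touched ?c (comp ?c x) x 0"
      by (simp_all add: no_bb_def one_touched_def)
    then show ?thesis unfolding good_def by blast
  next
    case True
    define T where "T = tr x"
    have T: "trunk V E {a} T" "x \<in> fst T"
      using trunk_tr[OF True x] by (simp_all add: T_def fst_tr)
    define W where "W = {p. ((T, x), p) \<in> (adj RE')\<^sup>*}"
    define D where "D = {e \<in> RE'. e \<subseteq> W}"
    have tr: "trunk RV RE' RC (W, D)"
      using trunk_component[OF T x] by (simp add: W_def D_def)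
    have WV: "W \<subseteq> RV" using tr by (auto simp: trunk_def trunk_cond_def)
    have step: "q \<in> W" if "p \<in> W" "{p, q} \<in> RE'" for p q
      using that unfolding W_def by (auto intro: rtrancl_into_rtrancl simp: adj_def)
    have edge: "(T, z) \<in> W" "{(T, y), (T, z)} \<in> D"
      if "(T, y) \<in> W" "y \<noteq> a" "{y, z} \<in> E" "big E y \<or> z \<noteq> a \<and> big E z" for y z
    proof -
      have "y \<in> fst T" using that WV by (auto simp: RV_iff)
      then have "{(T, y), (T, z)} \<in> RE'" using trunk_edge(1)[OF T(1)] that T(1) by (auto simp: RE'_iff)
      then show "(T, z) \<in> W" "{(T, y), (T, z)} \<in> D" using step that by (auto simp: D_def)
    qed
    have W: "(T, y) \<in> W \<and> y \<noteq> a" if "y \<in> comp ?c x" for y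
    proof -
      have "(x, y) \<in> (link {z. ?c z = None})\<^sup>*" using that by (simp add: comp_def)
      then show ?thesis
      proof (induction rule: rtrancl_induct)
        case base
        show ?case using x by (simp add: W_def)
      next
        case (step y z)
        then show ?case using edge(1)[of y z] by (auto simp: link_def split: if_splits)
      qed
    qed
    \<comment> \<open>A big-big edge of the component is visible both to (i), which takes degrees in
      the reduced graph, and to (ii), which takes them in the trunk.\<close>
    have bb: "{(T, y), (T, z)} \<in> D \<inter> E_ggt2 RE' \<and> {(T, y), (T, z)} \<in> E_ggt2 D"
      if "y \<in> comp ?c x" "z \<in> comp ?c x" "{y, z} \<in> E" "big E y" "big E z" for y z
    proof -
      have e: "{(T, y), (T, z)} \<in> D" using edge(2) W that by blast
      have "2 < deg RE' (T, v)" "2 < deg D (T, v)" if v: "v \<in> comp ?c x" "big E v" for v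
      proof -
        have f: "v \<in> fst T" "v \<noteq> a" using W[OF v(1)] WV by (auto simp: RV_iff)
        show "2 < deg RE' (T, v)" using big_sup_RE[OF T(1) f v(2) RE'_sub] by blast
        have "e \<in> D" if e: "e \<in> RE'" "(T, v) \<in> e" for e
        proof -
          have "e \<in> RE" using e RE'_sub by blast
          then obtain w where w: "e = {(T, v), (T, w)}" "trunk V E {a} T" "{v, w} \<in> snd T"
            using e(2) by (rule RE_at)
          then have "(T, w) \<in> W" using step W[OF v(1)] e by blast
          then show ?thesis using w e W[OF v(1)] by (auto simp: D_def)
        qed
        then show "2 < deg D (T, v)"
          using RE'_sub by (intro big_sup_RE[OF T(1) f v(2)]) (auto simp: D_def)
      qed
      then show ?thesis using e that by (auto simp: E_ggt2_def D_def)
    qed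
    have "(card (W \<inter> RC) = 1 \<and> D \<inter> E_ggt2 RE' = {})
      \<or> (W \<inter> RC = {} \<and> (\<exists>v\<in>W. covers v (E_ggt2 D)))"
      using assms tr unfolding root_cond_def by fastforce
    then show ?thesis
    proof
      assume "card (W \<inter> RC) = 1 \<and> D \<inter> E_ggt2 RE' = {}"
      then have "no_bb (comp ?c x)" using bb unfolding no_bb_def by blast
      moreover have "\<exists>u k. one_touched ?c (comp ?c x) u k"
        by (rule one_touched_single[where b = a]) (auto split: if_splits)
      ultimately show ?thesis unfolding good_def by blast
    next
      assume A: "W \<inter> RC = {} \<and> (\<exists>v\<in>W. covers v (E_ggt2 D))"
      then obtain S v where v: "covers (S, v) (E_ggt2 D)" by auto
      have "bb_cover v (comp ?c x)"
        unfolding bb_cover_def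
      proof (intro ballI impI)
        fix y z assume "y \<in> comp ?c x" "z \<in> comp ?c x" "{y, z} \<in> E" "big E y" "big E z"
        then have "{(T, y), (T, z)} \<in> E_ggt2 D" using bb by simp
        with v[unfolded covers_def] have "(S, v) \<in> {(T, y), (T, z)}" by (rule bspec)
        then show "v = y \<or> v = z" by auto
      qed
      moreover have "untouched ?c (comp ?c x)"
        unfolding untouched_def
      proof (intro ballI allI impI)
        fix y z assume y: "y \<in> comp ?c x" "big E y" "{y, z} \<in> E"
        have "z \<noteq> a"
        proof
          assume "z = a"
          then have aW: "(T, a) \<in> W" using edge(1)[of y a] W[OF y(1)] y(2,3) by simp
          then have "(T, a) \<in> RV" using WV by blast
          then have "(T, a) \<in> RC" by (simp add: RC_iff)
          then show False using A aW by blast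
        qed
        then show "?c z = None" by simp
      qed
      ultimately show ?thesis unfolding good_def by blast
    qed
  qed
  then show ?thesis by (auto simp: inv_def split: if_splits)
qed

text \<open>Pairwise intersecting edges either share a vertex or form a triangle. The first is
  excluded by hypothesis, the second in a forest.\<close>

lemma disjoint_edges:
  assumes S: "S \<subseteq> E" "e \<in> S" and nc: "\<And>v. v \<in> \<Union>S \<Longrightarrow> \<exists>e\<in>S. v \<notin> e"
  shows "\<exists>e1\<in>S. \<exists>e2\<in>S. e1 \<inter> e2 = {}"
proof (rule ccontr)
  assume n: "\<not> ?thesis"
  have other: "\<exists>y. d = {x, y} \<and> x \<noteq> y" if d: "d \<in> S" "x \<in> d" for d x
  proof -
    obtain s t where "d = {s, t}" "s \<noteq> t" using S(1) d(1) by (meson edge_obtain subsetD)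
    then show ?thesis using d(2) by (cases "x = s") (auto simp: insert_commute)
  qed
  obtain p q where e: "e = {p, q}" "p \<noteq> q" using S by (meson edge_obtain subsetD)
  have pq: "{p, q} \<in> S" using e S by simp
  then have pqU: "p \<in> \<Union>S" "q \<in> \<Union>S" by blast+
  obtain e2 where e2: "e2 \<in> S" "p \<notin> e2" using nc[OF pqU(1)] by blast
  have "{p, q} \<inter> e2 \<noteq> {}" using n pq e2(1) by blast
  then have "q \<in> e2" using e2(2) by simp
  then obtain r where r: "e2 = {q, r}" "q \<noteq> r" using other[OF e2(1)] by blast
  obtain e3 where e3: "e3 \<in> S" "q \<notin> e3" using nc[OF pqU(2)] by blast
  have "{p, q} \<inter> e3 \<noteq> {}" using n pq e3(1) by blast
  then have "p \<in> e3" using e3(2) by simp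
  then obtain t where t: "e3 = {p, t}" using other[OF e3(1)] by blast
  have "e2 \<inter> e3 \<noteq> {}" using n e2(1) e3(1) by blast
  then have "r \<in> e3" using r(1) e3(2) by simp
  have "p \<noteq> r" using e2(2) r(1) by simp
  then have "e3 = {p, r}" using t \<open>r \<in> e3\<close> by simp
  then have E: "{p, q} \<in> E" "{p, r} \<in> E" "{q, r} \<in> E" using S(1) pq e2(1) r(1) e3(1) by auto
  have "r \<in> branch E p q" using branch_nbr[of p q r] E \<open>p \<noteq> r\<close> by blast
  then have "r = q" using branch_unique[of p q r] E by simp
  then show False using r by simp
qed

text \<open>A failing trunk with a coloured copy has just one, as all its vertices carry the same
  \<open>T\<close>; so it contains a big-big edge, and the edge leaving the copy of \<open>a\<close>
  survived reduction because its other end \<open>u\<close> is big. A failing trunk without coloured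
  copies has no covering vertex, and \<open>disjoint_edges\<close> yields two edges.\<close>

lemma not_root_cond:
  assumes "\<not> root_cond"
  shows "(\<exists>u p p'. {a, u} \<in> E \<and> big E u \<and> (u, p) \<in> (link (V - {a}))\<^sup>* \<and> {p, p'} \<in> E \<and>
      big E p \<and> big E p' \<and> p \<noteq> a \<and> p' \<noteq> a) \<or>
    (\<exists>p p' r r' Y. {p, p'} \<in> E \<and> big E p \<and> big E p' \<and> {r, r'} \<in> E \<and> big E r \<and> big E r' \<and>
      {p, p'} \<inter> {r, r'} = {} \<and> (p, r) \<in> (link Y)\<^sup>* \<and> a \<notin> Y \<and>
      (\<forall>y\<in>Y. big E y \<longrightarrow> {a, y} \<notin> E) \<and> {p, p', r, r'} \<subseteq> Y)"
proof -
  obtain W D where T2: "trunk RV RE' RC (W, D)"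
    and n1: "\<not> (card (W \<inter> RC) = 1 \<and> D \<inter> E_ggt2 RE' = {})"
    and n2: "\<not> (W \<inter> RC = {} \<and> (\<exists>v\<in>W. covers v (E_ggt2 D)))"
    using assms unfolding root_cond_def by fastforce
  have t: "W \<subseteq> RV" "D \<subseteq> RE'" "connected_sg W D" "\<And>q. q \<in> W \<Longrightarrow> q \<in> RC \<Longrightarrow> deg D q = 1"
    using T2 by (auto simp: trunk_def trunk_cond_def)
  note con = connected_sgD[OF t(3)]
  obtain T x where Tx: "(T, x) \<in> W" using con(1) by auto
  have T: "trunk V E {a} T" using Tx t(1) by (auto simp: RV_iff)
  have same: "S = T" if "(S, y) \<in> W" for S y
  proof -
    have "((T, x), (S, y)) \<in> (adj D)\<^sup>*" using con(3) Tx that by blast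
    then have "fst (S, y) = T"
    proof (induction rule: rtrancl_induct)
      case (step y z)
      then show ?case using t(2) by (cases y; cases z) (auto simp: adj_def RE'_iff)
    qed simp
    then show ?thesis by simp
  qed
  have Dedge: "{u, v} \<in> E" "(u \<noteq> a \<and> big E u) \<or> (v \<noteq> a \<and> big E v)" if "{(T, u), (T, v)} \<in> D" for u v
    using that t(2) RE'_iff[of T u T v] trunk_facts(2)[OF T] by blast+
  have bb: "\<exists>p p'. e = {(T, p), (T, p')} \<and> {p, p'} \<in> E \<and> big E p \<and> big E p' \<and> p \<noteq> a \<and> p' \<noteq> a"
    if "e \<in> D" "e \<in> E_ggt2 D'" "D' \<subseteq> RE" for e D'
  proof -
    have "e \<subseteq> W" using con(2) that by blast
    have "e \<in> RE" using that t(2) RE'_sub by blast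
    then obtain S p p' where e: "e = {(S, p), (S, p')}" "trunk V E {a} S" "{p, p'} \<in> snd S"
      by (rule RE_obtain)
    then have "S = T" using \<open>e \<subseteq> W\<close> same by blast
    have "2 < deg D' (T, p)" "2 < deg D' (T, p')" using that e \<open>S = T\<close> by (auto simp: E_ggt2_def)
    then have "p \<noteq> a" "big E p" "p' \<noteq> a" "big E p'" using big_sub_RE[OF that(3)] by blast+
    then show ?thesis using e \<open>S = T\<close> Dedge(1)[of p p'] that by auto
  qed
  show ?thesis
  proof (cases "W \<inter> RC = {}")
    case False
    then have aW: "(T, a) \<in> W" "(T, a) \<in> RC" using same by (auto simp: RC_iff)
    have "q = (T, a)" if "q \<in> W" "q \<in> RC" for q
      using that same by (cases q) (simp add: RC_iff)
    then have "W \<inter> RC = {(T, a)}" using aW by blast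
    then have "card (W \<inter> RC) = 1" by simp
    then obtain e where "e \<in> D" "e \<in> E_ggt2 RE'" using n1 by blast
    then obtain p p' where p: "e = {(T, p), (T, p')}" "{p, p'} \<in> E" "big E p" "big E p'" "p \<noteq> a" "p' \<noteq> a"
      using bb RE'_sub by blast
    have d1: "deg D (T, a) = 1" using t(4) aW by blast
    then obtain e' where e': "e' \<in> D" "(T, a) \<in> e'" unfolding deg_def
      by (metis (no_types, lifting) card_1_singletonE mem_Collect_eq singletonI)
    then have "e' \<in> RE" using t(2) RE'_sub by blast
    then obtain u where u: "e' = {(T, a), (T, u)}" "trunk V E {a} T" "{a, u} \<in> snd T"
      using e'(2) by (rule RE_at)
    have au: "{a, u} \<in> E" "big E u" "u \<noteq> a" using Dedge[of a u] e' u edge_D(3)[of a u] by auto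
    have pW: "(T, p) \<in> W" using p \<open>e \<in> D\<close> con(2) by blast
    have "((T, a), (T, p)) \<in> (adj D)\<^sup>*" using con(3) aW pW by blast
    \<comment> \<open>A walk from the leaf \<open>(T, a)\<close> must first step to
      \<open>(T, u)\<close>. The first disjunct absorbs later returns to \<open>a\<close>, so no
      simple path has to be extracted.\<close>
    then have "(T, p) = (T, a) \<or> (\<exists>v. (T, p) = (T, v) \<and> v \<noteq> a \<and> (u, v) \<in> (link (V - {a}))\<^sup>*)"
    proof (induction rule: rtrancl_induct)
      case (step y z)
      have yz: "{y, z} \<in> D" using step by (simp add: adj_def)
      then obtain v where z: "z = (T, v)" using con(2)[OF yz] same by (cases z) auto
      from step.IH show ?case
      proof
        assume "y = (T, a)"
        then have "z = (T, u)" using deg_one_unique[OF d1, of z "(T, u)"] yz e' u by simp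
        then show ?thesis using au by auto
      next
        assume "\<exists>v. y = (T, v) \<and> v \<noteq> a \<and> (u, v) \<in> (link (V - {a}))\<^sup>*"
        then obtain w where w: "y = (T, w)" "w \<noteq> a" "(u, w) \<in> (link (V - {a}))\<^sup>*" by blast
        have E: "{w, v} \<in> E" "big E w \<or> big E v" using Dedge[of w v] yz z w by auto
        show ?thesis
        proof (cases "v = a")
          case False
          then have "(w, v) \<in> link (V - {a})" using E w edge_D[OF E(1)] by (auto simp: link_def)
          then show ?thesis using w z False by (auto intro: rtrancl_into_rtrancl)
        qed (use z in auto)
      qed
    qed simp
    then have "(u, p) \<in> (link (V - {a}))\<^sup>*" using p by auto
    then show ?thesis using au p by blast
  next
    case True
    define Y where "Y = {y. (T, y) \<in> W}"
    have Wf: "y \<in> fst T" if "y \<in> Y" for y using that t(1) by (auto simp: Y_def RV_iff)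
    have aY: "a \<notin> Y"
    proof
      assume "a \<in> Y"
      then have aW: "(T, a) \<in> W" by (simp add: Y_def)
      then have "(T, a) \<in> RV" using t(1) by blast
      then have "(T, a) \<in> RC" by (simp add: RC_iff)
      then show False using True aW by blast
    qed
    \<comment> \<open>The edge from \<open>a\<close> to a big \<open>y\<close> would survive
      reduction and could be added to the trunk as a leaf, against maximality.\<close>
    have nadj: "{a, y} \<notin> E" if y: "y \<in> Y" "big E y" for y
    proof
      assume "{a, y} \<in> E"
      then have ya: "{y, a} \<in> E" by (simp add: insert_commute)
      have yne: "y \<noteq> a" using y aY by auto
      have s: "{y, a} \<in> snd T" "a \<in> fst T" using trunk_edge[OF T Wf[OF y(1)] yne ya] by auto
      let ?e = "{(T, y), (T, a)}"
      let ?W = "insert (T, a) W" and ?D = "insert ?e D"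
      have eR: "?e \<in> RE'" using s T yne y by (auto simp: RE'_iff)
      have aW: "(T, a) \<notin> W" using aY by (simp add: Y_def)
      have yW: "(T, y) \<in> W" using y by (simp add: Y_def)
      have "trunk_cond RV RE' RC ?W ?D"
        unfolding trunk_cond_def
      proof (intro conjI)
        show "?W \<subseteq> RV" using t(1) s T by (auto simp: RV_iff)
        show "?D \<subseteq> RE'" using t(2) eR by auto
        have "adj D \<subseteq> adj ?D" by (auto simp: adj_def)
        then have m: "(adj D)\<^sup>* \<subseteq> (adj ?D)\<^sup>*" by (rule rtrancl_mono)
        show "connected_sg ?W ?D"
        proof (rule connected_sgI[of "(T, y)"])
          show "(T, y) \<in> ?W" using yW by simp
          show "e \<subseteq> ?W" if "e \<in> ?D" for e using that con(2) yW by blast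
          show "((T, y), q) \<in> (adj ?D)\<^sup>*" if "q \<in> ?W" for q
          proof (cases "q = (T, a)")
            case True
            then show ?thesis by (auto simp: adj_def)
          next
            case False
            then show ?thesis using that con(3) yW m by blast
          qed
        qed
        show "\<forall>c\<in>?W \<inter> RC. deg ?D c = 1"
        proof
          fix c assume "c \<in> ?W \<inter> RC"
          then have "c = (T, a)" using True by auto
          moreover have "{e \<in> ?D. (T, a) \<in> e} = {?e}" using con(2) aW by auto
          ultimately show "deg ?D c = 1" by (simp add: deg_def)
        qed
      qed
      then have "?W = W" using T2 unfolding trunk_def by auto
      then show False using aW by auto
    qed
    have DRE: "D \<subseteq> RE" using t(2) RE'_sub by blast
    \<comment> \<open>The big-big edges of the trunk with the component \<open>T\<close> stripped
      off, so that \<open>disjoint_edges\<close> can be applied in the forest.\<close>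
    define S where "S = {e. Pair T ` e \<in> E_ggt2 D}"
    have Spair: "Pair T ` e = {(T, p), (T, p')} \<Longrightarrow> e = {p, p'}" for e p p'
    proof -
      assume *: "Pair T ` e = {(T, p), (T, p')}"
      then have "snd ` Pair T ` e = {p, p'}" by simp
      then show "e = {p, p'}" by (simp add: image_image)
    qed
    have SD: "\<exists>p p'. e = {p, p'} \<and> {p, p'} \<in> E \<and> big E p \<and> big E p' \<and> p \<in> Y \<and> p' \<in> Y" if "e \<in> S" for e
    proof -
      have e: "Pair T ` e \<in> E_ggt2 D" "Pair T ` e \<in> D" using that by (auto simp: S_def E_ggt2_def)
      obtain p p' where p: "Pair T ` e = {(T, p), (T, p')}" "{p, p'} \<in> E" "big E p" "big E p'"
        using bb[OF e(2,1) DRE] by blast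
      moreover have "p \<in> Y" "p' \<in> Y" using con(2)[OF e(2)] p by (auto simp: Y_def)
      ultimately show ?thesis using Spair[OF p(1)] by blast
    qed
    have nc: "\<exists>e\<in>S. v \<notin> e" if "v \<in> Y" for v
    proof -
      have "\<not> covers (T, v) (E_ggt2 D)" using n2 True that by (auto simp: Y_def)
      then obtain e where e: "e \<in> E_ggt2 D" "(T, v) \<notin> e" by (auto simp: covers_def)
      then have "e \<in> D" by (simp add: E_ggt2_def)
      then obtain p p' where p: "e = {(T, p), (T, p')}" using bb[OF _ e(1) DRE] by blast
      then have "Pair T ` {p, p'} = e" by simp
      then have "{p, p'} \<in> S" using e by (simp add: S_def)
      moreover have "v \<notin> {p, p'}" using p e(2) by auto
      ultimately show ?thesis by (rule bexI[rotated])
    qed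
    have "x \<in> Y" using Tx by (simp add: Y_def)
    then obtain e where "e \<in> S" using nc by blast
    moreover have "S \<subseteq> E" using SD by blast
    moreover have "\<Union>S \<subseteq> Y" using SD by blast
    ultimately obtain e1 e2 where e: "e1 \<in> S" "e2 \<in> S" "e1 \<inter> e2 = {}"
      using disjoint_edges[of S e] nc by blast
    obtain p p' where p: "e1 = {p, p'}" "{p, p'} \<in> E" "big E p" "big E p'" "p \<in> Y" "p' \<in> Y"
      using SD[OF e(1)] by blast
    obtain r r' where r: "e2 = {r, r'}" "{r, r'} \<in> E" "big E r" "big E r'" "r \<in> Y" "r' \<in> Y"
      using SD[OF e(2)] by blast
    have "((T, p), (T, r)) \<in> (adj D)\<^sup>*" using con(3) p r by (simp add: Y_def)
    then have "(p, snd (T, r)) \<in> (link Y)\<^sup>*"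
    proof (induction rule: rtrancl_induct)
      case (step y z)
      have yz: "{y, z} \<in> D" using step by (simp add: adj_def)
      then have W: "y \<in> W" "z \<in> W" using con(2)[OF yz] by auto
      then have vw: "y = (T, snd y)" "z = (T, snd z)"
        using same[of "fst y" "snd y"] same[of "fst z" "snd z"] by (metis prod.collapse)+
      define v w where "v = snd y" and "w = snd z"
      note vw = vw[folded v_def w_def]
      have "(v, w) \<in> link Y" using Dedge[of v w] yz W vw by (auto simp: link_def Y_def)
      then show ?case using step.IH unfolding v_def w_def by (rule rtrancl_into_rtrancl[rotated])
    qed simp
    then have "(p, r) \<in> (link Y)\<^sup>*" by simp
    moreover have "{p, p'} \<inter> {r, r'} = {}" "{p, p', r, r'} \<subseteq> Y" using p(1,5,6) r(1,5,6) e(3) by simp_all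
    moreover have "\<forall>y\<in>Y. big E y \<longrightarrow> {a, y} \<notin> E" using nadj by simp
    ultimately show ?thesis using p(2-4) r(2-4) aY
      by (intro disjI2 exI[of _ p] exI[of _ p'] exI[of _ r] exI[of _ r'] exI[of _ Y] conjI)
  qed
qed

end

section \<open>Other numbers of colours\<close>

context forest_graph
begin

lemma blockedI:
  assumes "v \<in> V" "c v = None" "\<And>k. k < t \<Longrightarrow> sees E c v k"
  shows "blocked V E t c"
  unfolding blocked_def using assms by (intro bexI[of _ v]) (simp_all add: sees_def)

lemma many_colours_not_blocked:
  assumes "card V < t" shows "\<not> blocked V E t c"
proof
  assume "blocked V E t c"
  then obtain v where v: "\<forall>k<t. \<exists>u. {u, v} \<in> E \<and> c u = Some k" by (auto simp: blocked_def)
  have "{..<t} \<subseteq> (\<lambda>u. the (c u)) ` V"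
  proof
    fix k assume "k \<in> {..<t}"
    then obtain u where "{u, v} \<in> E" "c u = Some k" using v by auto
    then show "k \<in> (\<lambda>u. the (c u)) ` V" using edge_D(1) by (intro image_eqI[of _ _ u]) auto
  qed
  then have "card {..<t} \<le> card V" using fin_V by (meson card_image_le card_mono finite_imageI le_trans)
  then show False using assms by simp
qed

text \<open>Needed so that the least number in \<open>game_chromatic\<close> is attained: with more
  colours than vertices no vertex can ever be blocked.\<close>

lemma many_colours_win:
  assumes "card V < t" shows "alice_wins_A V E t c \<and> alice_wins_B V E t c"
proof (induction "card {v \<in> V. c v = None}" arbitrary: c rule: less_induct)
  case less
  have dec: "card {w \<in> V. (c(v := Some k)) w = None} < card {w \<in> V. c w = None}"
    if "legal_move V E t c v k" for v k
    using that fin_V by (intro psubset_card_mono) (auto simp: legal_move_def split: if_splits)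
  have nb: "\<not> blocked V E t c" by (rule many_colours_not_blocked[OF assms])
  show ?case
  proof (cases "all_colored V c")
    case True
    then show ?thesis by (auto intro: A_done B_done)
  next
    case False
    then obtain v where v: "v \<in> V" "c v = None" by (auto simp: all_colored_def)
    then obtain k where "legal_move V E t c v k"
      using nb unfolding blocked_def legal_move_def by metis
    then have "alice_wins_A V E t c" using nb less dec by (intro A_move) auto
    moreover have "alice_wins_B V E t c" using False nb less dec by (intro B_move) auto
    ultimately show ?thesis by simp
  qed
qed

lemma one_colour_blocked:
  "t \<le> 1 \<Longrightarrow> {u, v} \<in> E \<Longrightarrow> c u = Some 0 \<Longrightarrow> c v = None \<Longrightarrow> blocked V E t c"
  using edge_D(2)[of u v] by (intro blockedI[of v]) (auto simp: sees_def less_Suc_eq_le)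

text \<open>If Alice does not already block an end of the edge, Bob colours \<open>x\<close> and
  thereby blocks \<open>y\<close>. With no colours at all Alice has no legal move.\<close>

lemma one_colour_loses:
  assumes "{x, y} \<in> E" "t \<le> 1" shows "\<not> alice_wins_A V E t (\<lambda>_. None)"
proof (rule alice_moves)
  show "x \<in> V" using assms edge_D by blast
  fix m i assume lm: "legal_move V E t (\<lambda>_. None) m i"
  then have i: "i = 0" "0 < t" using assms(2) by (auto simp: legal_move_def)
  let ?c = "(\<lambda>_. None)(m := Some i)"
  have yx: "{y, x} \<in> E" "x \<noteq> y" using assms(1) edge_D(3) by (auto simp: insert_commute)
  show "\<not> alice_wins_B V E t ?c"
  proof (cases "m = x \<or> m = y \<or> {m, x} \<in> E")
    case True
    then have "blocked V E t ?c"
      using one_colour_blocked[OF assms(2), of m y ?c] one_colour_blocked[OF assms(2), of m x ?c]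
        assms(1) yx i edge_D(3)[of m x] by (auto simp: fun_upd_def)
    then show ?thesis by (rule blocked_loses)
  next
    case False
    show ?thesis
    proof (rule bob_moves)
      show "legal_move V E t ?c x 0"
        using False i edge_D(1)[OF assms(1)] by (auto simp: legal_move_def)
      have "blocked V E t (?c(x := Some 0))"
        using False yx by (intro one_colour_blocked[OF assms(2,1)]) auto
      then show "\<not> alice_wins_A V E t (?c(x := Some 0))" by (rule blocked_loses)
    qed
  qed
qed simp

lemma finish_two:
  assumes "{v, w} \<in> E" "c v = None" "c w = None" "\<not> sees E c w l" "sees E c v j" "j < 2" "l < 2" "j \<noteq> l"
  shows "\<not> alice_wins_B V E 2 c"
proof (rule bob_moves)
  show "legal_move V E 2 c w l" using assms edge_D[OF assms(1)] by (auto simp: legal_move_def sees_def)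
  let ?c = "c(w := Some l)"
  have s: "sees E ?c v j" "sees E ?c v l"
    using assms by (auto intro: sees_upd sees_new simp: insert_commute)
  have "sees E ?c v k" if "k < 2" for k
  proof -
    have "k = j \<or> k = l" using that assms by linarith
    then show ?thesis using s by blast
  qed
  then have "blocked V E 2 ?c" using assms(2) edge_D[OF assms(1)] by (intro blockedI[of v]) auto
  then show "\<not> alice_wins_A V E 2 ?c" by (rule blocked_loses)
qed

end

context forest_no3
begin

text \<open>A move at or next to the edge lets Bob block a neighbour of that move at once. Otherwise
  he makes \<open>x\<close> see Alice's colour \<open>i\<close>, so she must colour \<open>x\<close>
  with \<open>1 - i\<close>; then \<open>y\<close> sees \<open>1 - i\<close> and a neighbour of
  \<open>y\<close> takes \<open>i\<close>.\<close>

lemma two_colours_lose: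
  assumes xy: "{x, y} \<in> E" "big E x" "big E y"
  shows "\<not> alice_wins_A V E 2 (\<lambda>_. None)"
proof (rule alice_moves)
  show "x \<in> V" using assms edge_D by blast
  fix m i assume lm: "legal_move V E 2 (\<lambda>_. None) m i"
  let ?c = "(\<lambda>_. None)(m := Some i)"
  have i: "i < 2" using lm by (simp add: legal_move_def)
  have yx: "{y, x} \<in> E" "x \<noteq> y" using xy(1) edge_D(3) by (auto simp: insert_commute)
  have only: "\<not> sees E ?c w l" if "l \<noteq> i" for w l using that by (auto simp: sees_def)
  have l: "1 - i < 2" "1 - i \<noteq> i" using i by presburger+
  have done_at: "\<not> alice_wins_B V E 2 ?c" if "{m, v} \<in> E" "{v, w} \<in> E" "w \<noteq> m" for v w
  proof (rule finish_two[of v w ?c "1 - i" i])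
    show "?c v = None" using edge_D(3)[OF that(1)] by simp
    show "sees E ?c v i" using that by (auto simp: sees_def)
  qed (use that i l only in auto)
  show "\<not> alice_wins_B V E 2 ?c"
  proof (cases "m = x \<or> m = y \<or> {m, x} \<in> E \<or> {m, y} \<in> E")
    case True
    then consider "m = x" | "m = y" | "{m, x} \<in> E" "m \<noteq> y" | "{m, y} \<in> E" "m \<noteq> x" by blast
    then show ?thesis
    proof cases
      case 1
      obtain w where "{y, w} \<in> E" "w \<notin> {x, x}" using big_avoid_two[OF xy(3)] by metis
      then show ?thesis using done_at[of y w] 1 xy by auto
    next
      case 2
      obtain w where "{x, w} \<in> E" "w \<notin> {y, y}" using big_avoid_two[OF xy(2)] by metis
      then show ?thesis using done_at[of x w] 2 yx by auto
    next
      case 3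
      then show ?thesis using done_at[of x y] xy by auto
    next
      case 4
      then show ?thesis using done_at[of y x] yx by auto
    qed
  next
    case False
    then have F: "m \<noteq> x" "m \<noteq> y" "{x, m} \<notin> E" "{y, m} \<notin> E" by (auto simp: insert_commute)
    obtain t1 t2 t3 where t: "{x, t1} \<in> E" "{x, t2} \<in> E" "{x, t3} \<in> E" "distinct [y, t1, t2, t3]"
      using big_avoid_three[OF xy(2)] by metis
    have "\<exists>z w w'. {x, z} \<in> E \<and> {x, w} \<in> E \<and> {x, w'} \<in> E \<and> distinct [y, z, w, w'] \<and> m \<notin> branch E x z"
    proof (cases "m \<in> branch E x t1")
      case True
      then have "m \<notin> branch E x t2" using branch_disjoint[of x t1 t2 m] t by auto
      then show ?thesis using t by (intro exI[of _ t2] exI[of _ t1] exI[of _ t3]) auto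
    qed (use t in blast)
    then obtain z w w' where z: "{x, z} \<in> E" "{x, w} \<in> E" "{x, w'} \<in> E" "distinct [y, z, w, w']"
      "m \<notin> branch E x z" by blast
    have zm: "z \<noteq> m" using z(5) by auto
    have zne: "z \<noteq> x" "z \<noteq> y" using z edge_D(3)[OF z(1)] by auto
    \<comment> \<open>Repeating Alice's colour keeps \<open>1 - i\<close> off the board, so every
      free neighbour of \<open>x\<close> can receive it, even if Alice's first vertex lies in that
      branch.\<close>
    let ?d = "?c(z := Some i)"
    have okz: "ok ?c x z i" using z zm by (auto simp: ok_def)
    have xN: "?d x = None" "?d y = None" using F zne by auto
    show ?thesis
    proof (rule bob_moves)
      show "legal_move V E 2 ?c z i"
        using ok_not_sees[OF okz] F zm edge_D(2)[OF z(1)] i by (auto simp: legal_move_def sees_def)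
      show "\<not> alice_wins_A V E 2 ?d"
      proof (rule alice_moves)
        show "x \<in> V" "?d x = None" using xy edge_D xN by auto
        fix m' i' assume lm': "legal_move V E 2 ?d m' i'"
        let ?e = "?d(m' := Some i')"
        have mN: "?d m' = None" and i': "i' < 2" using lm' by (auto simp: legal_move_def)
        then have ne: "m' \<noteq> z" "m' \<noteq> m" using zm by (auto split: if_splits)
        have seen: "sees E ?d x i" using z by (auto simp: sees_def insert_commute)
        show "\<not> alice_wins_B V E 2 ?e"
        proof (cases "m' = x")
          case True
          have "i' \<noteq> i" using lm' seen True unfolding legal_move_def sees_def by blast
          then have "i' = 1 - i" using i i' by linarith
          obtain y1 y2 where y: "{y, y1} \<in> E" "{y, y2} \<in> E" "y1 \<noteq> y2" "y1 \<notin> {x, x}" "y2 \<notin> {x, x}"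
            using big_avoid_two[OF xy(3)] by metis
          \<comment> \<open>Here Bob will play \<open>i\<close>, the colour of \<open>m\<close>, so
            a branch at \<open>y\<close> free of \<open>m\<close> is needed; two neighbours of
            \<open>y\<close> other than \<open>x\<close> guarantee one.\<close>
          then have "m \<notin> branch E y y1 \<or> m \<notin> branch E y y2"
            using branch_disjoint[of y y1 y2 m] by blast
          then obtain y' where y': "{y, y'} \<in> E" "y' \<noteq> x" "m \<notin> branch E y y'" using y by auto
          have "z \<notin> branch E y y'" using branch_opposite[of y x y' z z] yx y' z zne by auto
          moreover have "x \<notin> branch E y y'" using branch_unique[of y y' x] yx y' by auto
          moreover have "y' \<noteq> m" using y'(3) by auto
          moreover have "z \<noteq> y'" "x \<noteq> y'" using calculation by auto
          ultimately have "ok ?e y y' i" using y' True by (auto simp: ok_def)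
          moreover have "?e y = None" using xN True yx by auto
          moreover have "sees E ?e y i'" using True xy by (auto simp: sees_def)
          ultimately show ?thesis using y' i l i' \<open>i' = 1 - i\<close> ok_not_sees
            by (intro finish_two[of y y' ?e i i']) (auto simp: ok_def)
        next
          case False
          have "m' \<notin> branch E x w \<or> m' \<notin> branch E x w'"
            using branch_disjoint[of x w w' m'] z by auto
          then obtain v where v: "{x, v} \<in> E" "v \<noteq> z" "m' \<notin> branch E x v" using z by auto
          have "v \<noteq> m" "v \<noteq> m'" using v F by auto
          then have okv: "ok ?e x v (1 - i)" using v l by (auto simp: ok_def)
          have eN: "?e x = None" using xN False by simp
          have s: "sees E ?e x i" using seen mN by (rule sees_upd)
          have vN: "?e v = None" using okv unfolding ok_def by blast
          show ?thesis
            by (rule finish_two[OF v(1) eN vN ok_not_sees[OF okv eN] s i l(1) l(2)[symmetric]])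
        qed
      qed
    qed
  qed
qed simp

end

theorem theorem7p3:
  fixes V :: "'a set" and E :: "'a set set"
  assumes "forest V E"
    and "V \<noteq> {}"
    and "\<forall>v\<in>V. deg E v \<noteq> 3"
  shows "game_chromatic V E < 4 \<longleftrightarrow>
    (\<exists>a\<in>V. \<forall>T. trunk (R_V V E {a}) (R'_E V E {a}) (R_C V E {a}) T \<longrightarrow>
        (card (fst T \<inter> R_C V E {a}) = 1 \<and> snd T \<inter> E_ggt2 (R'_E V E {a}) = {})
      \<or> (fst T \<inter> R_C V E {a} = {} \<and> (\<exists>v\<in>fst T. covers v (E_ggt2 (snd T)))))"
proof -
  interpret forest_no3 V E using assms by unfold_locales
  have root: "coloured_root V E a" if "a \<in> V" for a using that by unfold_locales
  have "game_chromatic V E < 4 \<longleftrightarrow> (\<exists>a\<in>V. coloured_root.root_cond V E a)"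
  proof
    assume "\<exists>a\<in>V. coloured_root.root_cond V E a"
    then obtain a where a: "a \<in> V" "coloured_root.root_cond V E a" by blast
    let ?c = "(\<lambda>_. None)(a := Some 0)"
    have "winsB ?c" by (rule inv_wins[OF coloured_root.root_cond_imp_inv[OF root[OF a(1)] a(2)]])
    moreover have "\<not> blocked V E 3 (\<lambda>_. None)"
      by (auto simp: blocked_def intro!: exI[of _ 0])
    moreover have "legal_move V E 3 (\<lambda>_. None) a 0" using a by (simp add: legal_move_def)
    ultimately have "winsA (\<lambda>_. None)" by (rule A_move[rotated 2])
    then have "game_chromatic V E \<le> 3" unfolding game_chromatic_def by (rule Least_le)
    then show "game_chromatic V E < 4" by simp
  next
    assume lt: "game_chromatic V E < 4"
    have win: "alice_wins_A V E (game_chromatic V E) (\<lambda>_. None)"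
    proof -
      have "alice_wins_A V E (Suc (card V)) (\<lambda>_. None)"
        by (rule many_colours_win[OF lessI, THEN conjunct1])
      then show ?thesis unfolding game_chromatic_def by (rule LeastI)
    qed
    show "\<exists>a\<in>V. coloured_root.root_cond V E a"
    proof (rule ccontr)
      assume n: "\<not> ?thesis"
      have lose: "\<not> winsB ((\<lambda>_. None)(a := Some k))" if "a \<in> V" "k < 3" for a k
      proof -
        have "\<not> coloured_root.root_cond V E a" using n that(1) by blast
        from coloured_root.not_root_cond[OF root[OF that(1)] this] show ?thesis
        proof (elim disjE exE conjE)
          fix u p p'
          assume "{a, u} \<in> E" "big E u" "(u, p) \<in> (link (V - {a}))\<^sup>*" "{p, p'} \<in> E"
            "big E p" "big E p'" "p \<noteq> a" "p' \<noteq> a"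
          then show ?thesis using that(2) by (rule Bob_wins_touched)
        next
          fix p p' r r' Y
          assume "{p, p'} \<in> E" "big E p" "big E p'" "{r, r'} \<in> E" "big E r" "big E r'"
            "{p, p'} \<inter> {r, r'} = {}" "(p, r) \<in> (link Y)\<^sup>*" "a \<notin> Y"
            "\<forall>y\<in>Y. big E y \<longrightarrow> {a, y} \<notin> E" "{p, p', r, r'} \<subseteq> Y"
          then show ?thesis using that(2) by (intro Bob_wins_two_edges[of p p' r r' Y a]) auto
        qed
      qed
      obtain x where x: "x \<in> V" using assms(2) by blast
      have "\<not> coloured_root.root_cond V E x" using n x by blast
      from coloured_root.not_root_cond[OF root[OF x] this]
      \<comment> \<open>Both ways in which the condition fails supply a big-big edge, which is what
        the refutation of fewer than three colours uses.\<close>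
      have "\<exists>p p'. {p, p'} \<in> E \<and> big E p \<and> big E p'" by (elim disjE exE conjE) blast+
      then obtain p p' where p: "{p, p'} \<in> E" "big E p" "big E p'" by blast
      have "\<not> winsA (\<lambda>_. None)"
        using lose x by (intro alice_moves[of x]) (auto simp: legal_move_def)
      moreover have "game_chromatic V E \<le> 1 \<or> game_chromatic V E = 2 \<or> game_chromatic V E = 3"
        using lt by linarith
      ultimately show False
        using win one_colour_loses[OF p(1)] two_colours_lose[OF p] by metis
    qed
  qed
  also have "\<dots> \<longleftrightarrow> (\<exists>a\<in>V. \<forall>T. trunk (R_V V E {a}) (R'_E V E {a}) (R_C V E {a}) T \<longrightarrow>
        (card (fst T \<inter> R_C V E {a}) = 1 \<and> snd T \<inter> E_ggt2 (R'_E V E {a}) = {})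
      \<or> (fst T \<inter> R_C V E {a} = {} \<and> (\<exists>v\<in>fst T. covers v (E_ggt2 (snd T)))))"
    using coloured_root.root_cond_def[OF root] by (intro bex_cong refl) simp
  finally show ?thesis .
qed

end
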